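(* Let $(x_i)_{i\ge1}$ be i.i.d. $\mathcal N(0,1)$ random variables and $(a_i)_{i\ge1}$ a non-decreasing sequence of positive reals with $\sum_i a_i^{-2}<\infty$. Let $z=\sum_{i=1}^\infty x_i^2/a_i^2$ and $F(s)=\mathbb{P}(z<s)$. Then $F\in\Gamma_0$ with auxiliary function \[ \rho(s)=\frac{1}{\mu^{-1}(s)}\quad (s>0 \text{ small}),\qquad \rho(0)=0, \] where $\mu(\theta)=\sum_{i=1}^\infty \frac{1}{a_i^2+2\theta}$ and $\mu^{-1}$ denotes the inverse function of $\mu$ (which is strictly decreasing from $(0,\infty)$ onto $(0,\mu(0))$).
   Context: Definition of $\Gamma_0$: $\Gamma_0$ is the class of functions $F:\mathbb{R}\to\mathbb{R}^+$ which vanish on $(-\infty,0]$ (in particular $F(0)=0$), are non-decreasing and right-continuous, and for which there exists a continuous non-decreasing function $\rho:\mathcal V^+\to\mathbb{R}^+$ defined on a right-neighbourhood $\mathcal V^+$ of $0$, with $\rho(0)=0$ (called an auxiliary function of $F$), such that for every $x\in\mathbb{R}$, \[ \lim_{s\downarrow 0}\frac{F(s+x\rho(s))}{F(s)}=e^{x}. \] *)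

theory Defs
  imports "HOL-Probability.Probability"
begin

definition is_aux_fun :: "(real \<Rightarrow> real) \<Rightarrow> (real \<Rightarrow> real) \<Rightarrow> bool" where
  "is_aux_fun F \<rho> \<longleftrightarrow>
     (\<exists>\<delta>>0. continuous_on {0..\<delta>} \<rho> \<and> mono_on {0..\<delta>} \<rho> \<and> (\<forall>s\<in>{0..\<delta>}. 0 \<le> \<rho> s)) \<and>
     \<rho> 0 = 0 \<and>
     (\<forall>x::real. ((\<lambda>s. F (s + x * \<rho> s) / F s) \<longlongrightarrow> exp x) (at_right 0))"

definition Gamma0 :: "(real \<Rightarrow> real) set" where
  "Gamma0 = {F. (\<forall>s. 0 \<le> F s) \<and> (\<forall>s\<le>0. F s = 0) \<and> mono F \<and>
                (\<forall>s. continuous (at_right s) F) \<and> (\<exists>\<rho>. is_aux_fun F \<rho>)}"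

end

theory Submission
  imports Defs "HOL-Real_Asymp.Real_Asymp"
begin

text \<open>
  The distribution function \<open>G\<close> of \<open>z\<close> is log-concave: passing from \<open>n\<close> to \<open>n + 1\<close> summands replaces
  \<open>G s\<close> by the Gaussian average of \<open>G (s - c * y\<^sup>2)\<close>, where \<open>s - c * y\<^sup>2\<close> is jointly concave in \<open>(s, y)\<close>,
  and the integrands are even and decreasing in \<open>\<bar>y\<bar>\<close>, so their level sets are symmetric intervals
  and the Prekopa-Leindler inequality reduces to comparing lengths.

  No local limit theorem is needed after that. Write \<open>s = \<mu> \<theta>\<close> and let \<open>k\<close> be the slope of a chord
  of \<open>ln G\<close> over an interval within distance \<open>O(1 / \<theta>)\<close> of \<open>s\<close>. If \<open>k < \<theta> * (1 - \<epsilon>)\<close>, then \<open>G\<close> is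
  dominated by an exponential to the right of the chord, and comparing the Laplace transform at two points
  strictly between \<open>\<theta> * (1 - \<epsilon>)\<close> and \<open>\<theta>\<close> bounds \<open>- \<theta>\<^sup>2 * \<mu>' \<theta>\<close>, which however tends to infinity. The case
  \<open>k > \<theta> * (1 + \<epsilon>)\<close> is symmetric. Hence \<open>k / \<theta>\<close> tends to \<open>1\<close>, which is the required limit.
\<close>

section \<open>Log-concavity of Gaussian averages\<close>

text \<open>Closure under smaller absolute values makes \<open>A\<close> an interval with end points
  \<open>- Sup A\<close> and \<open>Sup A\<close>. It contains both or neither of them, which does
  not affect its length.\<close>

lemma symmetric_interval_measure:
  fixes A :: "real set"
  assumes "0 \<in> A" and "\<And>x. x \<in> A \<Longrightarrow> \<bar>x\<bar> \<le> R" and dc: "\<And>x y. x \<in> A \<Longrightarrow> \<bar>y\<bar> \<le> \<bar>x\<bar> \<Longrightarrow> y \<in> A"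
  shows "emeasure lborel A = ennreal (2 * Sup A)"
proof -
  let ?S = "Sup A"
  have bdd: "bdd_above A" using assms(2) by (metis abs_le_D1 bdd_above.I)
  have S0: "0 \<le> ?S" using assms(1) bdd by (rule cSup_upper)
  have le: "\<bar>x\<bar> \<le> ?S" if "x \<in> A" for x
    by (rule cSup_upper[OF _ bdd]) (use dc[OF that, of "\<bar>x\<bar>"] in simp)
  have mem: "x \<in> A" if x: "\<bar>x\<bar> < ?S" for x
  proof -
    obtain y where "y \<in> A" "\<bar>x\<bar> < y" using less_cSupD[OF _ x] assms(1) by blast
    then show ?thesis using dc[of y x] by simp
  qed
  have "A = {-?S..?S} \<or> A = {-?S<..<?S}"
  proof (cases "?S \<in> A")
    case True
    have "A = {-?S..?S}" using le dc[OF True] S0 by force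
    then show ?thesis by blast
  next
    case False
    have ne: "\<bar>x\<bar> \<noteq> ?S" if "x \<in> A" for x using dc[OF that, of ?S] False by auto
    have "A = {-?S<..<?S}"
    proof (rule set_eqI)
      fix x show "x \<in> A \<longleftrightarrow> x \<in> {-?S<..<?S}" using le[of x] ne[of x] mem[of x] by (auto simp: abs_less_iff)
    qed
    then show ?thesis by blast
  qed
  then show ?thesis
    using S0 by (metis emeasure_lborel_Icc emeasure_lborel_Ioo diff_minus_eq_add mult_2 neg_le_0_iff_le order_trans)
qed

text \<open>Tonelli on the region \<open>0 \<le> t < f x\<close> under the graph. Negative values of
  \<open>f\<close> count as 0 on both sides, through \<open>ennreal\<close> on the left and the
  indicator on the right.\<close>

lemma nn_integral_layer_cake:
  fixes f :: "real \<Rightarrow> real"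
  assumes [measurable]: "f \<in> borel_measurable borel"
  shows "(\<integral>\<^sup>+x. ennreal (f x) \<partial>lborel) = (\<integral>\<^sup>+t. indicator {0..} t * emeasure lborel {x. t < f x} \<partial>lborel)"
proof -
  have "(\<integral>\<^sup>+x. ennreal (f x) \<partial>lborel) = (\<integral>\<^sup>+x. (\<integral>\<^sup>+t. indicator {0..<f x} t \<partial>lborel) \<partial>lborel)"
  proof (rule nn_integral_cong)
    fix x show "ennreal (f x) = (\<integral>\<^sup>+t. indicator {0..<f x} t \<partial>lborel)"
      by (cases "0 \<le> f x") (auto simp: ennreal_neg)
  qed
  also have "\<dots> = (\<integral>\<^sup>+x. (\<integral>\<^sup>+t. (if 0 \<le> t \<and> t < f x then 1 else 0) \<partial>lborel) \<partial>lborel)"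
    by (intro nn_integral_cong) (auto simp: indicator_def)
  also have "\<dots> = (\<integral>\<^sup>+t. (\<integral>\<^sup>+x. (if 0 \<le> t \<and> t < f x then 1 else 0) \<partial>lborel) \<partial>lborel)"
    by (rule lborel_pair.Fubini') measurable
  also have "\<dots> = (\<integral>\<^sup>+t. (\<integral>\<^sup>+x. indicator {0..} t * indicator {x. t < f x} x \<partial>lborel) \<partial>lborel)"
    by (intro nn_integral_cong) (auto simp: indicator_def)
  also have "\<dots> = (\<integral>\<^sup>+t. indicator {0..} t * emeasure lborel {x. t < f x} \<partial>lborel)"
    by (intro nn_integral_cong) (simp add: nn_integral_cmult)
  finally show ?thesis .
qed

text \<open>At each level \<open>t\<close> the mixtures of points of \<open>A\<close> and
  \<open>B\<close> lie in \<open>C\<close>; for symmetric intervals this compares half-lengths, and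
  the layer cake formula integrates the comparison. With both peaks equal to 1, \<open>A\<close> and
  \<open>B\<close> are nonempty for the same \<open>t \<ge> 0\<close>, so that no level has only one
  of them to mix.\<close>

lemma prekopa_leindler_even_normalized:
  fixes f g h :: "real \<Rightarrow> real"
  assumes l: "0 < l" "l < 1"
    and f: "\<And>x y. \<bar>x\<bar> \<le> \<bar>y\<bar> \<Longrightarrow> f y \<le> f x" "f 0 = 1" "\<And>x. 0 \<le> f x" "\<And>x. R < \<bar>x\<bar> \<Longrightarrow> f x = 0" "integrable lborel f"
    and g: "\<And>x y. \<bar>x\<bar> \<le> \<bar>y\<bar> \<Longrightarrow> g y \<le> g x" "g 0 = 1" "\<And>x. 0 \<le> g x" "\<And>x. R < \<bar>x\<bar> \<Longrightarrow> g x = 0" "integrable lborel g"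
    and h: "\<And>x y. \<bar>x\<bar> \<le> \<bar>y\<bar> \<Longrightarrow> h y \<le> h x" "\<And>x. 0 \<le> h x" "\<And>x. R < \<bar>x\<bar> \<Longrightarrow> h x = 0" "integrable lborel h"
    and min: "\<And>x y. min (f x) (g y) \<le> h (l * x + (1 - l) * y)"
  shows "l * (\<integral>x. f x \<partial>lborel) + (1 - l) * (\<integral>x. g x \<partial>lborel) \<le> (\<integral>x. h x \<partial>lborel)"
proof -
  have [measurable]: "f \<in> borel_measurable borel" "g \<in> borel_measurable borel" "h \<in> borel_measurable borel"
    using f(5) g(5) h(4) by (auto dest: borel_measurable_integrable)
  have levels: "emeasure lborel {x. t < k x} = ennreal (2 * Sup {x. t < k x})"
    if "\<And>x y. \<bar>x\<bar> \<le> \<bar>y\<bar> \<Longrightarrow> k y \<le> k x" "\<And>x. R < \<bar>x\<bar> \<Longrightarrow> k x = 0" "0 \<le> t" "t < k 0" for k :: "real \<Rightarrow> real" and t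
    by (rule symmetric_interval_measure[where R=R])
       (use that in \<open>force intro: order.strict_trans2 simp: not_le[symmetric]\<close>)+
  have key: "ennreal l * (indicator {0..} t * emeasure lborel {x. t < f x}) + ennreal (1 - l) * (indicator {0..} t * emeasure lborel {x. t < g x})
      \<le> indicator {0..} t * emeasure lborel {x. t < h x}" for t
  proof (cases "0 \<le> t \<and> t < 1")
    case True
    define A B C where "A = {x. t < f x}" and "B = {x. t < g x}" and "C = {x. t < h x}"
    have t0: "t < f 0" "t < g 0" using f(2) g(2) True by auto
    have sub: "l * x + (1 - l) * y \<in> C" if "x \<in> A" "y \<in> B" for x y
      using min[of x y] that by (auto simp: A_def B_def C_def)
    have "t < h 0" using sub[of 0 0] t0 by (simp add: A_def B_def C_def)
    have bdd: "bdd_above {x. t < k x}" if "\<And>x. R < \<bar>x\<bar> \<Longrightarrow> k x = 0" for k :: "real \<Rightarrow> real"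
      proof (rule bdd_aboveI[of _ R])
      fix x assume "x \<in> {x. t < k x}"
      then show "x \<le> R" using that[of x] True by (cases "R < \<bar>x\<bar>") auto
    qed
    have S0: "0 \<le> Sup A" "0 \<le> Sup B"
      using t0 bdd[of f] bdd[of g] f(4) g(4) by (auto intro!: cSup_upper simp: A_def B_def)
    \<comment> \<open>The two suprema are taken in turn: over \<open>x\<close> with \<open>y\<close>
      fixed, then over \<open>y\<close>.\<close>
    have 1: "l * Sup A + (1 - l) * y \<le> Sup C" if "y \<in> B" for y
    proof -
      have "Sup A \<le> (Sup C - (1 - l) * y) / l"
      proof (rule cSup_least)
        fix x assume "x \<in> A"
        then have "l * x + (1 - l) * y \<le> Sup C"
          using sub[OF _ that] bdd[of h] h(3) by (intro cSup_upper) (auto simp: C_def)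
        then show "x \<le> (Sup C - (1 - l) * y) / l" using l by (simp add: field_simps)
      qed (use t0 in \<open>auto simp: A_def\<close>)
      then show ?thesis using l by (simp add: field_simps)
    qed
    have "Sup B \<le> (Sup C - l * Sup A) / (1 - l)"
    proof (rule cSup_least)
      fix y assume "y \<in> B"
      then show "y \<le> (Sup C - l * Sup A) / (1 - l)" using 1[of y] l by (simp add: field_simps)
    qed (use t0 in \<open>auto simp: B_def\<close>)
    then have 2: "l * Sup A + (1 - l) * Sup B \<le> Sup C" using l by (simp add: field_simps)
    have "ennreal l * emeasure lborel A + ennreal (1 - l) * emeasure lborel B = ennreal (2 * (l * Sup A + (1 - l) * Sup B))"
      using levels[of f t] levels[of g t] f(1,4) g(1,4) t0 True l S0
      by (simp add: A_def[symmetric] B_def[symmetric] ennreal_mult[symmetric] ennreal_plus[symmetric] distrib_left mult.left_commute del: ennreal_plus)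
    also have "\<dots> \<le> emeasure lborel C"
      using levels[of h t] h(1,3) \<open>t < h 0\<close> True 2 by (auto simp: C_def[symmetric] intro!: ennreal_leI)
    finally show ?thesis using True by (simp add: A_def B_def C_def)
  next
    case False
    have "{x. t < f x} = {}" "{x. t < g x} = {}" if "1 \<le> t"
      using f(1)[of 0] g(1)[of 0] f(2) g(2) that by (auto simp: not_less intro: order_trans)
    then show ?thesis using False by (cases "0 \<le> t") auto
  qed
  have "ennreal l * (\<integral>\<^sup>+x. ennreal (f x) \<partial>lborel) + ennreal (1 - l) * (\<integral>\<^sup>+x. ennreal (g x) \<partial>lborel) \<le> (\<integral>\<^sup>+x. ennreal (h x) \<partial>lborel)"
    unfolding nn_integral_layer_cake[OF \<open>f \<in> _\<close>] nn_integral_layer_cake[OF \<open>g \<in> _\<close>] nn_integral_layer_cake[OF \<open>h \<in> _\<close>]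
    by (subst (1 2) nn_integral_cmult[symmetric], measurable, subst nn_integral_add[symmetric], measurable)
       (rule nn_integral_mono, rule key)
  then show ?thesis
    using l f(3) g(3) h(2)
    by (simp add: nn_integral_eq_integral f(5) g(5) h(4) ennreal_mult[symmetric] ennreal_plus[symmetric] del: ennreal_plus)
qed

text \<open>Dividing \<open>f\<close> and \<open>g\<close> by their values at 0, and
  \<open>h\<close> by the weighted geometric mean \<open>K\<close> of these values, reduces to peaks
  of height 1, because a minimum is at most a weighted geometric mean. Young's inequality then
  passes from the arithmetic mean of the integrals to the geometric one.\<close>

lemma prekopa_leindler_even:
  fixes f g h :: "real \<Rightarrow> real"
  assumes l: "0 < l" "l < 1"
    and f: "\<And>x y. \<bar>x\<bar> \<le> \<bar>y\<bar> \<Longrightarrow> f y \<le> f x" "\<And>x. 0 \<le> f x" "\<And>x. R < \<bar>x\<bar> \<Longrightarrow> f x = 0" "integrable lborel f"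
    and g: "\<And>x y. \<bar>x\<bar> \<le> \<bar>y\<bar> \<Longrightarrow> g y \<le> g x" "\<And>x. 0 \<le> g x" "\<And>x. R < \<bar>x\<bar> \<Longrightarrow> g x = 0" "integrable lborel g"
    and h: "\<And>x y. \<bar>x\<bar> \<le> \<bar>y\<bar> \<Longrightarrow> h y \<le> h x" "\<And>x. 0 \<le> h x" "\<And>x. R < \<bar>x\<bar> \<Longrightarrow> h x = 0" "integrable lborel h"
    and fgh: "\<And>x y. f x powr l * g y powr (1 - l) \<le> h (l * x + (1 - l) * y)"
  shows "(\<integral>x. f x \<partial>lborel) powr l * (\<integral>x. g x \<partial>lborel) powr (1 - l) \<le> (\<integral>x. h x \<partial>lborel)"
proof (cases "f 0 = 0 \<or> g 0 = 0")
  case True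
  \<comment> \<open>A peak of height 0 makes the function vanish identically, and its integral
    enters the product as \<open>0 powr _ = 0\<close>.\<close>
  then have "f = (\<lambda>_. 0) \<or> g = (\<lambda>_. 0)"
    using f(1,2)[of 0] f(2) g(1)[of 0] g(2) by (auto intro!: ext antisym)
  then show ?thesis using h(2) by (auto intro!: integral_nonneg_AE)
next
  case False
  have pos: "0 < f 0" "0 < g 0" using False f(2)[of 0] g(2)[of 0] by auto
  define K where "K = f 0 powr l * g 0 powr (1 - l)"
  have K: "0 < K" using pos by (simp add: K_def)
  have nn: "0 \<le> (\<integral>x. f x \<partial>lborel)" "0 \<le> (\<integral>x. g x \<partial>lborel)" using f(2) g(2) by (auto intro!: integral_nonneg_AE)
  have "l * (\<integral>x. f x / f 0 \<partial>lborel) + (1 - l) * (\<integral>x. g x / g 0 \<partial>lborel) \<le> (\<integral>x. h x / K \<partial>lborel)"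
  proof (rule prekopa_leindler_even_normalized[where R=R])
    fix x y
    let ?m = "min (f x / f 0) (g y / g 0)"
    have "?m = ?m powr l * ?m powr (1 - l)"
      using f(2)[of x] g(2)[of y] pos by (simp add: powr_add[symmetric])
    also have "\<dots> \<le> (f x / f 0) powr l * (g y / g 0) powr (1 - l)"
      using l f(2) g(2) pos by (intro mult_mono powr_mono2) auto
    also have "\<dots> = f x powr l * g y powr (1 - l) / K"
      using f(2)[of x] g(2)[of y] pos by (simp add: K_def powr_divide)
    also have "\<dots> \<le> h (l * x + (1 - l) * y) / K"
      using fgh[of x y] K by (simp add: divide_right_mono)
    finally show "?m \<le> h (l * x + (1 - l) * y) / K" .
  qed (use l f g h pos K in \<open>auto simp: divide_right_mono\<close>)
  then have 1: "l * ((\<integral>x. f x \<partial>lborel) / f 0) + (1 - l) * ((\<integral>x. g x \<partial>lborel) / g 0) \<le> (\<integral>x. h x \<partial>lborel) / K"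
    by simp
  have "(\<integral>x. f x \<partial>lborel) powr l * (\<integral>x. g x \<partial>lborel) powr (1 - l) / K
      = ((\<integral>x. f x \<partial>lborel) / f 0) powr l * ((\<integral>x. g x \<partial>lborel) / g 0) powr (1 - l)"
    using nn pos by (simp add: K_def powr_divide)
  also have "\<dots> \<le> l * ((\<integral>x. f x \<partial>lborel) / f 0) + (1 - l) * ((\<integral>x. g x \<partial>lborel) / g 0)"
  proof (cases "(\<integral>x. f x \<partial>lborel) = 0 \<or> (\<integral>x. g x \<partial>lborel) = 0")
    case True then show ?thesis using l nn pos by auto
  next
    case False then show ?thesis using l nn pos by (intro Youngs_inequality_0) auto
  qed
  finally show ?thesis using 1 K by (simp add: divide_le_cancel) (use K in \<open>smt (verit, best) divide_le_cancel\<close>)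
qed

text \<open>The multiplicative form with \<open>powr\<close> admits zeros, as distribution functions
  require: since \<open>0 powr l = 0\<close>, a zero at \<open>s\<close> or \<open>t\<close> asks
  only for a nonnegative value in between.\<close>

definition log_concave :: "(real \<Rightarrow> real) \<Rightarrow> bool" where
  "log_concave f \<longleftrightarrow> (\<forall>l s t. 0 < l \<longrightarrow> l < 1 \<longrightarrow> f s powr l * f t powr (1 - l) \<le> f (l * s + (1 - l) * t))"

text \<open>Since \<open>G\<close> is monotone and log-concave and \<open>r - c * y\<^sup>2\<close>
  is concave in \<open>(r, y)\<close>, the integrand, Gaussian density included, is jointly
  log-concave; the inequality above integrates \<open>y\<close> out. This is the induction step that
  adds one squared Gaussian summand.\<close>

lemma log_concave_gaussian_average:
  fixes G :: "real \<Rightarrow> real"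
  assumes mono: "mono G" and G0: "\<And>s. 0 \<le> G s" "\<And>s. G s \<le> 1" "\<And>s. s < 0 \<Longrightarrow> G s = 0"
    and lc: "log_concave G" and c: "0 < c"
  shows "log_concave (\<lambda>s. \<integral>y. std_normal_density y * G (s - c * y\<^sup>2) \<partial>lborel)"
  unfolding log_concave_def
proof (intro allI impI)
  fix l s t :: real assume l: "0 < l" "l < 1"
  let ?u = "l * s + (1 - l) * t"
  \<comment> \<open>A common bound for the three supports. The summand 1 ensures
    \<open>R \<le> R\<^sup>2\<close>, so that \<open>R < \<bar>y\<bar>\<close> gives
    \<open>R < y\<^sup>2\<close> and a negative argument of \<open>G\<close>.\<close>
  define R where "R = 1 + max 0 (max s (max t ?u)) / c"
  have [measurable]: "G \<in> borel_measurable borel" using mono by (rule borel_measurable_mono)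
  have supp: "std_normal_density y * G (r - c * y\<^sup>2) = 0" if "r \<le> max 0 (max s (max t ?u))" "R < \<bar>y\<bar>" for r y
  proof -
    let ?m = "max 0 (max s (max t ?u))"
    have "1 \<le> R" using c by (simp add: R_def)
    then have "R * 1 \<le> R * R" by (intro mult_left_mono) auto
    also have "R * R < \<bar>y\<bar> * \<bar>y\<bar>" using that(2) \<open>1 \<le> R\<close> by (intro mult_strict_mono) auto
    finally have "R < y\<^sup>2" by (simp add: power2_eq_square)
    then have "?m / c < y\<^sup>2" unfolding R_def by linarith
    then have "?m < c * y\<^sup>2" using c by (simp add: field_simps)
    then have "r - c * y\<^sup>2 < 0" using that(1) by linarith
    then show ?thesis using G0(3) by simp
  qed
  have anti: "std_normal_density y * G (r - c * y\<^sup>2) \<le> std_normal_density x * G (r - c * x\<^sup>2)" if "\<bar>x\<bar> \<le> \<bar>y\<bar>" for r x y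
  proof -
    have "x\<^sup>2 \<le> y\<^sup>2" using that by (simp add: abs_le_square_iff)
    then show ?thesis using c G0(1)
      by (intro mult_mono monoD[OF mono]) (auto simp: std_normal_density_def divide_right_mono)
  qed
  have int: "integrable lborel (\<lambda>y. std_normal_density y * G (r - c * y\<^sup>2))" for r
    by (rule Bochner_Integration.integrable_bound[where f=std_normal_density])
       (use G0 in \<open>auto simp: abs_mult intro!: mult_left_le integrable_normal_density\<close>)
  show "(\<integral>y. std_normal_density y * G (s - c * y\<^sup>2) \<partial>lborel) powr l * (\<integral>y. std_normal_density y * G (t - c * y\<^sup>2) \<partial>lborel) powr (1 - l)
      \<le> (\<integral>y. std_normal_density y * G (?u - c * y\<^sup>2) \<partial>lborel)"
  proof (rule prekopa_leindler_even[where R=R])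
    fix x y :: real
    let ?w = "l * x + (1 - l) * y"
    have conv: "?w\<^sup>2 \<le> l * x\<^sup>2 + (1 - l) * y\<^sup>2"
    proof -
      have "l * x\<^sup>2 + (1 - l) * y\<^sup>2 - ?w\<^sup>2 = l * (1 - l) * (x - y)\<^sup>2" by (simp add: power2_eq_square algebra_simps)
      also have "0 \<le> \<dots>" using l by simp
      finally show ?thesis by simp
    qed
    have phi: "std_normal_density x powr l * std_normal_density y powr (1 - l) \<le> std_normal_density ?w"
    proof -
      have "std_normal_density x powr l * std_normal_density y powr (1 - l)
         = (1 / sqrt (2 * pi)) powr l * (1 / sqrt (2 * pi)) powr (1 - l) * exp (- (l * x\<^sup>2 + (1 - l) * y\<^sup>2) / 2)"
        by (simp add: std_normal_density_def powr_mult powr_def exp_add[symmetric] ln_div ln_mult algebra_simps add_divide_distrib diff_divide_distrib)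
      also have "\<dots> = 1 / sqrt (2 * pi) * exp (- (l * x\<^sup>2 + (1 - l) * y\<^sup>2) / 2)"
        by (simp add: powr_add[symmetric])
      also have "\<dots> \<le> std_normal_density ?w" using conv by (simp add: std_normal_density_def divide_right_mono)
      finally show ?thesis .
    qed
    have "G (s - c * x\<^sup>2) powr l * G (t - c * y\<^sup>2) powr (1 - l) \<le> G (l * (s - c * x\<^sup>2) + (1 - l) * (t - c * y\<^sup>2))"
      using lc l by (simp add: log_concave_def)
    also have "\<dots> \<le> G (?u - c * ?w\<^sup>2)"
      using mult_left_mono[OF conv, of c] c by (intro monoD[OF mono]) (simp add: algebra_simps)
    finally show "(std_normal_density x * G (s - c * x\<^sup>2)) powr l * (std_normal_density y * G (t - c * y\<^sup>2)) powr (1 - l)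
       \<le> std_normal_density ?w * G (?u - c * ?w\<^sup>2)"
      using mult_mono[OF phi, of "G (s - c * x\<^sup>2) powr l * G (t - c * y\<^sup>2) powr (1 - l)"] G0(1)
      by (simp add: powr_mult mult.assoc mult.left_commute)
  qed (use l G0 int anti supp in \<open>auto\<close>)
qed

section \<open>Log-concave functions and Laplace transforms\<close>


text \<open>Here \<open>k\<close> is the slope of the chord of \<open>ln G\<close> over
  \<open>{u..v}\<close>, and a concave function lies below the line of a chord outside its interval.
  On the left, points where \<open>G\<close> vanishes satisfy the bound trivially.\<close>

lemma log_concave_extrapolate:
  assumes lc: "log_concave G" and pos: "\<And>s. 0 < s \<Longrightarrow> 0 < G s" "\<And>s. 0 \<le> G s"
    and uv: "0 < u" "u < v" and k: "G v = G u * exp (k * (v - u))"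
  shows "v \<le> t \<Longrightarrow> G t \<le> G v * exp (k * (t - v))"
    and "t \<le> u \<Longrightarrow> G t \<le> G u * exp (k * (t - u))"
proof -
  \<comment> \<open>Three-point concavity of \<open>ln G\<close> cleared of denominators:
    \<open>b\<close> is the mean of \<open>a\<close> and \<open>c\<close> with weights
    \<open>(c - b) / (c - a)\<close> and \<open>(b - a) / (c - a)\<close>.\<close>
  have conv: "(c - b) * ln (G a) + (b - a) * ln (G c) \<le> (c - a) * ln (G b)"
    if "a < b" "b < c" "0 < G a" "0 < G b" "0 < G c" for a b c
  proof -
    let ?l = "(c - b) / (c - a)"
    have l1: "1 - ?l = (b - a) / (c - a)" using that by (simp add: field_simps)
    have "?l * a + (1 - ?l) * c = ((c - b) * a + (b - a) * c) / (c - a)" unfolding l1 by (simp add: add_divide_distrib)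
    also have "(c - b) * a + (b - a) * c = b * (c - a)" by (simp add: algebra_simps)
    finally have l2: "?l * a + (1 - ?l) * c = b" using that by simp
    have "G a powr ?l * G c powr (1 - ?l) \<le> G (?l * a + (1 - ?l) * c)"
      by (rule lc[unfolded log_concave_def, rule_format]) (use that in auto)
    then have "ln (G a powr ?l * G c powr (1 - ?l)) \<le> ln (G b)"
      unfolding l2 using that by (subst ln_le_cancel_iff) auto
    then have "?l * ln (G a) + (1 - ?l) * ln (G c) \<le> ln (G b)"
      using that by (simp add: ln_mult ln_powr)
    then have "((c - b) * ln (G a) + (b - a) * ln (G c)) / (c - a) \<le> ln (G b)"
      unfolding l1 by (simp add: add_divide_distrib)
    then show ?thesis using that by (simp add: pos_divide_le_eq mult.commute)
  qed
  have Gu: "0 < G u" and Gv: "0 < G v" using pos uv by auto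
  have ln_k: "ln (G v) = ln (G u) + k * (v - u)" unfolding k using Gu by (simp add: ln_mult)
  have right: "G t \<le> G v * exp (k * (t - v))" if "v \<le> t"
  proof (cases "v = t")
    case False
    then have vt: "v < t" using that by simp
    have Gt: "0 < G t" using pos uv vt by simp
    have eq: "ln (G u) = ln (G v) - k * (v - u)" unfolding ln_k by (simp only: add_diff_cancel_right')
    have "(v - u) * (ln (G v) + k * (t - v)) - (v - u) * ln (G t)
        = (t - u) * ln (G v) - ((t - v) * (ln (G v) - k * (v - u)) + (v - u) * ln (G t))"
      by (simp add: algebra_simps)
    then have "(v - u) * ln (G t) \<le> (v - u) * (ln (G v) + k * (t - v))"
      using conv[OF uv(2) vt Gu Gv Gt] unfolding eq by linarith
    then have "ln (G t) \<le> ln (G v) + k * (t - v)" using uv by simp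
    then have "exp (ln (G t)) \<le> exp (ln (G v) + k * (t - v))" by simp
    then show ?thesis using Gt Gv by (simp add: exp_add)
  qed simp
  have left: "G t \<le> G u * exp (k * (t - u))" if "t \<le> u"
  proof (cases "t = u \<or> G t = 0")
    case False
    then have tu: "t < u" and Gt: "0 < G t" using that pos(2)[of t] by auto
    have "(v - u) * (ln (G u) + k * (t - u)) - (v - u) * ln (G t)
        = (v - t) * ln (G u) - ((v - u) * ln (G t) + (u - t) * (ln (G u) + k * (v - u)))"
      by (simp add: algebra_simps)
    then have "(v - u) * ln (G t) \<le> (v - u) * (ln (G u) + k * (t - u))"
      using conv[OF tu uv(2) Gt Gu Gv] unfolding ln_k by linarith
    then have "ln (G t) \<le> ln (G u) + k * (t - u)" using uv by simp
    then have "exp (ln (G t)) \<le> exp (ln (G u) + k * (t - u))" by simp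
    then show ?thesis using Gt Gu by (simp add: exp_add)
  qed (use Gu in auto)
  show "v \<le> t \<Longrightarrow> G t \<le> G v * exp (k * (t - v))" by (rule right)
  show "t \<le> u \<Longrightarrow> G t \<le> G u * exp (k * (t - u))" by (rule left)
qed

text \<open>A concave function is continuous on an open interval, and \<open>G\<close> is the
  exponential of one there. This later excludes atoms of the series at positive points.\<close>

lemma log_concave_continuous:
  assumes lc: "log_concave G" and pos: "\<And>s. 0 < s \<Longrightarrow> 0 < G s"
  shows "continuous_on {0<..} G"
proof -
  have "concave_on {0<..} (\<lambda>s. ln (G s))"
    unfolding concave_on_iff
  proof (intro conjI ballI allI impI)
    fix x y u v :: real assume xy: "x \<in> {0<..}" "y \<in> {0<..}" and uv: "0 \<le> u" "0 \<le> v" "u + v = 1"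
    show "u * ln (G x) + v * ln (G y) \<le> ln (G (u *\<^sub>R x + v *\<^sub>R y))"
    proof (cases "u = 0 \<or> v = 0")
      case False
      have v: "v = 1 - u" "0 < u" "u < 1" using False uv by auto
      then have "G x powr u * G y powr v \<le> G (u * x + v * y)"
        using lc[unfolded log_concave_def, rule_format, of u x y] v by simp
      moreover have "0 < u * x + v * y" using xy uv False by (auto intro!: add_pos_nonneg)
      ultimately have "ln (G x powr u * G y powr v) \<le> ln (G (u * x + v * y))"
        using pos[of x] pos[of y] pos[of "u * x + v * y"] xy by simp
      then show ?thesis using pos[of x] pos[of y] xy by (simp add: ln_mult ln_powr)
    qed (use uv in auto)
  qed auto
  then have "continuous_on {0<..} (\<lambda>s. - ln (G s))"
    unfolding concave_on_def by (intro convex_on_continuous) auto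
  then have "continuous_on {0<..} (\<lambda>s. exp (- (- ln (G s))))"
    by (rule continuous_on_exp[OF continuous_on_minus])
  then show ?thesis
    by (rule continuous_on_eq) (simp add: pos)
qed

section \<open>Exponential integrals and the comparison of Laplace transforms\<close>

lemma has_bochner_integral_le:
  fixes f g :: "'a \<Rightarrow> real"
  assumes "has_bochner_integral M f x" "has_bochner_integral M g y" "\<And>t. f t \<le> g t"
  shows "x \<le> y"
  using assms integral_mono[of M f g] by (simp add: has_bochner_integral_iff)

lemma has_bochner_integral_exp_right:
  fixes c p K :: real
  assumes "0 < c"
  shows "has_bochner_integral lborel (\<lambda>t. K * (exp (- c * (t - p)) * indicator {p..} t)) (K / c)"
proof -
  have "((\<lambda>x. - (exp (- c * (x - p)) / c)) \<longlongrightarrow> - (0 / c)) at_top"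
    using assms by (intro tendsto_intros) (real_asymp, simp)
  moreover have "((\<lambda>x. - (exp (- c * (x - p)) / c)) has_real_derivative exp (- c * (x - p))) (at x)" for x
    using assms by (auto intro!: derivative_eq_intros)
  ultimately have "(\<integral>\<^sup>+t. ennreal (exp (- c * (t - p))) * indicator {p..} t \<partial>lborel) = ennreal (0 - - (exp (- c * (p - p)) / c))"
    by (intro nn_integral_FTC_atLeast) auto
  then have "has_bochner_integral lborel (\<lambda>t. exp (- c * (t - p)) * indicator {p..} t) (1 / c)"
    using assms by (intro has_bochner_integral_nn_integral) (auto simp: ennreal_mult' ennreal_indicator)
  from has_bochner_integral_mult_right[OF this, of K] show ?thesis by simp
qed

lemma has_bochner_integral_exp_left:
  fixes c p K :: real
  assumes "0 < c"
  shows "has_bochner_integral lborel (\<lambda>t. K * (exp (c * (t - p)) * indicator {..p} t)) (K / c)"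
proof -
  \<comment> \<open>Reflection at \<open>p\<close> exchanges the two half-lines.\<close>
  have "indicator {p..} (2 * p - x) = (indicator {..p} x :: real)" for x by (auto simp: indicator_def)
  then show ?thesis
    using has_bochner_integral_exp_right[OF assms, of K p]
    by (subst (asm) lborel_has_bochner_integral_real_affine_iff[where c="-1" and t="2*p"]) (simp_all add: algebra_simps)
qed

text \<open>After recentring at \<open>p\<close>, the weight for \<open>\<theta>1\<close> is the
  smaller one left of \<open>p\<close>, so its integral exceeds that for \<open>\<theta>2\<close>
  only through \<open>{p..}\<close>, where the growth bound limits the excess to
  \<open>G p / (\<theta>1 - \<kappa>)\<close>. Monotonicity bounds \<open>G p\<close> by
  \<open>\<theta>2\<close> times the recentred integral for \<open>\<theta>2\<close>.\<close>

lemma laplace_compare_right: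
  fixes G J :: "real \<Rightarrow> real"
  assumes mono: "mono G" and G0: "\<And>s. 0 \<le> G s"
    and J: "\<And>\<theta>. 0 < \<theta> \<Longrightarrow> has_bochner_integral lborel (\<lambda>t. exp (- \<theta> * t) * G t) (J \<theta>)"
    and th: "0 < \<theta>1" "\<theta>1 < \<theta>2" "\<kappa> < \<theta>1"
    and G: "\<And>t. p \<le> t \<Longrightarrow> G t \<le> G p * exp (\<kappa> * (t - p))"
  shows "exp (\<theta>1 * p) * J \<theta>1 \<le> (1 + \<theta>2 / (\<theta>1 - \<kappa>)) * (exp (\<theta>2 * p) * J \<theta>2)"
proof -
  have J': "has_bochner_integral lborel (\<lambda>t. exp (- \<theta> * (t - p)) * G t) (exp (\<theta> * p) * J \<theta>)" if "0 < \<theta>" for \<theta>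
  proof -
    have "exp (- \<theta> * (t - p)) = exp (\<theta> * p) * exp (- \<theta> * t)" for t
      unfolding exp_add[symmetric] by (simp add: right_diff_distrib)
    then show ?thesis
      using has_bochner_integral_mult_right[OF J[OF that], of "exp (\<theta> * p)"] by (simp only: mult.assoc)
  qed
  have "G p / \<theta>2 \<le> exp (\<theta>2 * p) * J \<theta>2"
    by (rule has_bochner_integral_le[OF has_bochner_integral_exp_right[where p=p and K="G p"] J'])
       (use th mono G0 in \<open>auto simp: indicator_def mult.commute intro!: mult_right_mono monoD[OF mono]\<close>)
  moreover have "exp (\<theta>1 * p) * J \<theta>1 - exp (\<theta>2 * p) * J \<theta>2 \<le> G p / (\<theta>1 - \<kappa>)"
  proof (rule has_bochner_integral_le[OF has_bochner_integral_diff[OF J' J'] has_bochner_integral_exp_right])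
    fix t
    show "exp (- \<theta>1 * (t - p)) * G t - exp (- \<theta>2 * (t - p)) * G t \<le> G p * (exp (- (\<theta>1 - \<kappa>) * (t - p)) * indicator {p..} t)"
    proof (cases "p \<le> t")
      case True
      have "exp (- \<theta>1 * (t - p)) * G t - exp (- \<theta>2 * (t - p)) * G t \<le> exp (- \<theta>1 * (t - p)) * G t" using G0 by simp
      also have "\<dots> \<le> exp (- \<theta>1 * (t - p)) * (G p * exp (\<kappa> * (t - p)))" using G[OF True] by simp
      also have "\<dots> = G p * exp (- \<theta>1 * (t - p) + \<kappa> * (t - p))" unfolding exp_add by (simp only: mult.left_commute)
      also have "- \<theta>1 * (t - p) + \<kappa> * (t - p) = - (\<theta>1 - \<kappa>) * (t - p)" by (simp add: algebra_simps)
      finally show ?thesis using True by simp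
    next
      case False
      have "- \<theta>1 * (t - p) \<le> - \<theta>2 * (t - p)" using False th by (simp add: mult_right_mono_neg)
      then have "exp (- \<theta>1 * (t - p)) * G t \<le> exp (- \<theta>2 * (t - p)) * G t" by (intro mult_right_mono G0) simp
      then show ?thesis using False by simp
    qed
  qed (use th in auto)
  moreover have "G p / (\<theta>1 - \<kappa>) = \<theta>2 / (\<theta>1 - \<kappa>) * (G p / \<theta>2)" using th by simp
  moreover have "\<theta>2 / (\<theta>1 - \<kappa>) * (G p / \<theta>2) \<le> \<theta>2 / (\<theta>1 - \<kappa>) * (exp (\<theta>2 * p) * J \<theta>2)" if "G p / \<theta>2 \<le> exp (\<theta>2 * p) * J \<theta>2"
    by (rule mult_left_mono[OF that]) (use th in simp)
  ultimately show ?thesis by (simp add: distrib_right)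
qed

text \<open>Right of \<open>p\<close> the weight for \<open>\<theta>2\<close> is the smaller one, so
  the excess comes from \<open>{..p}\<close>. The bound on \<open>G p\<close> is still taken from
  \<open>{p..}\<close>, where \<open>G\<close> is at least \<open>G p\<close>.\<close>

lemma laplace_compare_left:
  fixes G J :: "real \<Rightarrow> real"
  assumes mono: "mono G" and G0: "\<And>s. 0 \<le> G s"
    and J: "\<And>\<theta>. 0 < \<theta> \<Longrightarrow> has_bochner_integral lborel (\<lambda>t. exp (- \<theta> * t) * G t) (J \<theta>)"
    and th: "0 < \<theta>1" "\<theta>1 < \<theta>2" "\<theta>2 < \<kappa>"
    and G: "\<And>t. t \<le> p \<Longrightarrow> G t \<le> G p * exp (\<kappa> * (t - p))"
  shows "exp (\<theta>2 * p) * J \<theta>2 \<le> (1 + \<theta>1 / (\<kappa> - \<theta>2)) * (exp (\<theta>1 * p) * J \<theta>1)"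
proof -
  have J': "has_bochner_integral lborel (\<lambda>t. exp (- \<theta> * (t - p)) * G t) (exp (\<theta> * p) * J \<theta>)" if "0 < \<theta>" for \<theta>
  proof -
    have "exp (- \<theta> * (t - p)) = exp (\<theta> * p) * exp (- \<theta> * t)" for t
      unfolding exp_add[symmetric] by (simp add: right_diff_distrib)
    then show ?thesis
      using has_bochner_integral_mult_right[OF J[OF that], of "exp (\<theta> * p)"] by (simp only: mult.assoc)
  qed
  have "G p / \<theta>1 \<le> exp (\<theta>1 * p) * J \<theta>1"
    by (rule has_bochner_integral_le[OF has_bochner_integral_exp_right[where p=p and K="G p"] J'])
       (use th mono G0 in \<open>auto simp: indicator_def mult.commute intro!: mult_right_mono monoD[OF mono]\<close>)
  moreover have "exp (\<theta>2 * p) * J \<theta>2 - exp (\<theta>1 * p) * J \<theta>1 \<le> G p / (\<kappa> - \<theta>2)"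
  proof (rule has_bochner_integral_le[OF has_bochner_integral_diff[OF J' J'] has_bochner_integral_exp_left])
    fix t
    show "exp (- \<theta>2 * (t - p)) * G t - exp (- \<theta>1 * (t - p)) * G t \<le> G p * (exp ((\<kappa> - \<theta>2) * (t - p)) * indicator {..p} t)"
    proof (cases "t \<le> p")
      case True
      have "exp (- \<theta>2 * (t - p)) * G t - exp (- \<theta>1 * (t - p)) * G t \<le> exp (- \<theta>2 * (t - p)) * G t" using G0 by simp
      also have "\<dots> \<le> exp (- \<theta>2 * (t - p)) * (G p * exp (\<kappa> * (t - p)))" using G[OF True] by simp
      also have "\<dots> = G p * exp (- \<theta>2 * (t - p) + \<kappa> * (t - p))" unfolding exp_add by (simp only: mult.left_commute)
      also have "- \<theta>2 * (t - p) + \<kappa> * (t - p) = (\<kappa> - \<theta>2) * (t - p)" by (simp add: algebra_simps)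
      finally show ?thesis using True by simp
    next
      case False
      have "- \<theta>2 * (t - p) \<le> - \<theta>1 * (t - p)" using False th by (simp add: mult_right_mono)
      then have "exp (- \<theta>2 * (t - p)) * G t \<le> exp (- \<theta>1 * (t - p)) * G t" by (intro mult_right_mono G0) simp
      then show ?thesis using False by simp
    qed
  qed (use th in auto)
  moreover have "G p / (\<kappa> - \<theta>2) = \<theta>1 / (\<kappa> - \<theta>2) * (G p / \<theta>1)" using th by simp
  moreover have "\<theta>1 / (\<kappa> - \<theta>2) * (G p / \<theta>1) \<le> \<theta>1 / (\<kappa> - \<theta>2) * (exp (\<theta>1 * p) * J \<theta>1)" if "G p / \<theta>1 \<le> exp (\<theta>1 * p) * J \<theta>1"
    by (rule mult_left_mono[OF that]) (use th in simp)
  ultimately show ?thesis by (simp add: distrib_right)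
qed

section \<open>Slopes of \<open>ln G\<close> near \<open>\<mu> \<theta>\<close>\<close>

text \<open>The model is a distribution function \<open>G\<close> whose measure has Laplace
  transform \<open>L\<close>; integration by parts then gives \<open>L \<theta> / \<theta>\<close>.
  \<open>L_ge\<close> and \<open>L_le\<close> place the tangents of slope \<open>- \<mu>\<close>
  below \<open>ln L\<close>, and \<open>curv\<close> is the difference form of
  \<open>- \<theta>\<^sup>2 * \<mu>' \<theta>\<close> tending to infinity.\<close>

locale log_concave_laplace =
  fixes G L \<mu> :: "real \<Rightarrow> real"
  assumes mono_G: "mono G" and G_nonneg: "\<And>s. 0 \<le> G s" and G_pos: "\<And>s. 0 < s \<Longrightarrow> 0 < G s"
    and lc: "log_concave G"
    and L_pos: "\<And>\<theta>. 0 < \<theta> \<Longrightarrow> 0 < L \<theta>"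
    and laplace: "\<And>\<theta>. 0 < \<theta> \<Longrightarrow> has_bochner_integral lborel (\<lambda>t. exp (- \<theta> * t) * G t) (L \<theta> / \<theta>)"
    and L_ge: "\<And>\<alpha> \<beta>. 0 < \<alpha> \<Longrightarrow> \<alpha> < \<beta> \<Longrightarrow> exp ((\<beta> - \<alpha>) * \<mu> \<beta>) * L \<beta> \<le> L \<alpha>"
    and L_le: "\<And>\<alpha> \<beta>. 0 < \<alpha> \<Longrightarrow> \<alpha> < \<beta> \<Longrightarrow> L \<alpha> \<le> exp ((\<beta> - \<alpha>) * \<mu> \<alpha>) * L \<beta>"
    and curv: "\<And>N. \<exists>T. \<forall>\<alpha> \<beta>. 0 < \<alpha> \<longrightarrow> \<alpha> \<le> \<beta> \<longrightarrow> T \<le> \<beta> \<longrightarrow> real N * (2 * (\<beta> - \<alpha>) / (9 * \<beta>\<^sup>2)) \<le> \<mu> \<alpha> - \<mu> \<beta>"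
    and growth: "LIM \<theta> at_top. \<theta> * \<mu> \<theta> :> at_top"
begin

text \<open>Such slow growth beyond \<open>v\<close> would give \<open>exp ((\<beta> - \<alpha>) *
  (\<mu> \<beta> - v)) \<le> 1 + 3 / \<epsilon>\<close> for two rates below \<open>\<theta>\<close>,
  by \<open>laplace_compare_right\<close> and \<open>L_ge\<close>. But \<open>curv\<close> lifts
  \<open>\<mu> \<beta>\<close> above \<open>\<mu> \<theta>\<close> by an arbitrarily large multiple
  of \<open>1 / \<theta>\<close>.\<close>

lemma eventually_not_slow:
  assumes "0 < \<epsilon>" "\<epsilon> < 1"
  shows "\<forall>\<^sub>F \<theta> in at_top. \<forall>v \<le> \<mu> \<theta> + C / \<theta>. \<not> (\<forall>t\<ge>v. G t \<le> G v * exp (\<theta> * (1 - \<epsilon>) * (t - v)))"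
proof -
  have "LIM N sequentially. exp (2 * real N * \<epsilon>\<^sup>2 / 81 - \<epsilon> / 3 * C) :> at_top"
    using assms(1) by real_asymp
  then have "\<forall>\<^sub>F N in sequentially. 1 + 3 / \<epsilon> < exp (2 * real N * \<epsilon>\<^sup>2 / 81 - \<epsilon> / 3 * C)"
    by (simp add: filterlim_at_top_dense)
  \<comment> \<open>\<open>N\<close> depends on \<open>\<epsilon>\<close> and \<open>C\<close> only.
    The exponent is the lower bound for \<open>(\<beta> - \<alpha>) * (\<mu> \<beta> - v)\<close>
    that \<open>curv\<close> yields with this \<open>N\<close>.\<close>
  then obtain N :: nat where N: "1 + 3 / \<epsilon> < exp (2 * real N * \<epsilon>\<^sup>2 / 81 - \<epsilon> / 3 * C)"
    using eventually_happens'[OF sequentially_bot] by blast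
  obtain T where T: "\<And>\<alpha> \<beta>. 0 < \<alpha> \<Longrightarrow> \<alpha> \<le> \<beta> \<Longrightarrow> T \<le> \<beta> \<Longrightarrow> real N * (2 * (\<beta> - \<alpha>) / (9 * \<beta>\<^sup>2)) \<le> \<mu> \<alpha> - \<mu> \<beta>"
    using curv[of N] by blast
  have "\<not> (\<forall>t\<ge>v. G t \<le> G v * exp (\<theta> * (1 - \<epsilon>) * (t - v)))"
    if \<theta>: "0 < \<theta>" "T \<le> \<theta>" and v: "v \<le> \<mu> \<theta> + C / \<theta>" for \<theta> v
  proof
    assume G: "\<forall>t\<ge>v. G t \<le> G v * exp (\<theta> * (1 - \<epsilon>) * (t - v))"
    \<comment> \<open>The rates cut the interval from \<open>\<theta> * (1 - \<epsilon>)\<close> to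
      \<open>\<theta>\<close> into thirds: one gap makes the dominating integral converge, one
      separates the transforms, and one produces the gain
      \<open>\<mu> \<beta> - \<mu> \<theta>\<close>.\<close>
    define \<alpha> \<beta> where "\<alpha> = \<theta> * (1 - 2 * \<epsilon> / 3)" and "\<beta> = \<theta> * (1 - \<epsilon> / 3)"
    have ord: "0 < \<alpha>" "\<alpha> < \<beta>" "\<beta> < \<theta>" "\<theta> * (1 - \<epsilon>) < \<alpha>" using assms \<theta> by (auto simp: \<alpha>_def \<beta>_def)
    have d: "\<alpha> - \<theta> * (1 - \<epsilon>) = \<epsilon> * \<theta> / 3" "\<beta> - \<alpha> = \<epsilon> * \<theta> / 3" "\<theta> - \<beta> = \<epsilon> * \<theta> / 3"
      by (auto simp: \<alpha>_def \<beta>_def algebra_simps)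
    have "exp (\<alpha> * v) * (L \<alpha> / \<beta>) \<le> exp (\<alpha> * v) * (L \<alpha> / \<alpha>)"
      using ord L_pos[of \<alpha>] by (intro mult_left_mono divide_left_mono) auto
    also have "\<dots> \<le> (1 + \<beta> / (\<alpha> - \<theta> * (1 - \<epsilon>))) * (exp (\<beta> * v) * (L \<beta> / \<beta>))"
      using ord G by (intro laplace_compare_right[OF mono_G G_nonneg laplace]) auto
    also have "\<dots> \<le> (1 + 3 / \<epsilon>) * (exp (\<beta> * v) * (L \<beta> / \<beta>))"
    proof (rule mult_right_mono)
      have "\<beta> / (\<alpha> - \<theta> * (1 - \<epsilon>)) \<le> \<theta> / (\<epsilon> * \<theta> / 3)"
        unfolding d(1) using ord \<theta> assms by (intro divide_right_mono) auto
      then show "1 + \<beta> / (\<alpha> - \<theta> * (1 - \<epsilon>)) \<le> 1 + 3 / \<epsilon>" using \<theta> assms by simp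
    qed (use ord L_pos[of \<beta>] in auto)
    finally have "exp (\<alpha> * v) * L \<alpha> \<le> (1 + 3 / \<epsilon>) * (exp (\<beta> * v) * L \<beta>)"
      using ord by (simp add: divide_le_cancel)
    moreover have "exp (\<alpha> * v) * (exp ((\<beta> - \<alpha>) * \<mu> \<beta>) * L \<beta>) \<le> exp (\<alpha> * v) * L \<alpha>"
      using L_ge ord by (intro mult_left_mono) auto
    ultimately have "exp (\<alpha> * v + (\<beta> - \<alpha>) * \<mu> \<beta>) * L \<beta> \<le> (1 + 3 / \<epsilon>) * exp (\<beta> * v) * L \<beta>"
      unfolding exp_add by (simp only: mult.assoc)
    then have "exp (\<alpha> * v + (\<beta> - \<alpha>) * \<mu> \<beta>) \<le> (1 + 3 / \<epsilon>) * exp (\<beta> * v)"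
      using L_pos[of \<beta>] ord by simp
    then have "exp (\<alpha> * v + (\<beta> - \<alpha>) * \<mu> \<beta>) / exp (\<beta> * v) \<le> 1 + 3 / \<epsilon>"
      by (simp add: pos_divide_le_eq)
    then have 1: "exp ((\<beta> - \<alpha>) * (\<mu> \<beta> - v)) \<le> 1 + 3 / \<epsilon>"
      by (simp add: exp_diff[symmetric] algebra_simps)
    have "real N * (2 * (\<theta> - \<beta>) / (9 * \<theta>\<^sup>2)) - C / \<theta> \<le> \<mu> \<beta> - v"
      using T[of \<beta> \<theta>] \<theta> ord v by simp
    then have "(\<beta> - \<alpha>) * (real N * (2 * (\<theta> - \<beta>) / (9 * \<theta>\<^sup>2)) - C / \<theta>) \<le> (\<beta> - \<alpha>) * (\<mu> \<beta> - v)"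
      using ord by (intro mult_left_mono) auto
    also have "(\<beta> - \<alpha>) * (real N * (2 * (\<theta> - \<beta>) / (9 * \<theta>\<^sup>2)) - C / \<theta>) = 2 * real N * \<epsilon>\<^sup>2 / 81 - \<epsilon> / 3 * C"
      unfolding d using \<theta> by (simp add: field_simps power2_eq_square)
    finally have "exp (2 * real N * \<epsilon>\<^sup>2 / 81 - \<epsilon> / 3 * C) \<le> exp ((\<beta> - \<alpha>) * (\<mu> \<beta> - v))" by simp
    then show False using 1 N by linarith
  qed
  then show ?thesis
    by (intro eventually_mono[OF eventually_conj[OF eventually_gt_at_top[of 0] eventually_ge_at_top[of T]]]) blast
qed

text \<open>The same contradiction with both rates above \<open>\<theta>\<close>, from
  \<open>laplace_compare_left\<close> and \<open>L_le\<close>; the gain is now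
  \<open>\<mu> \<theta> - \<mu> \<alpha>\<close>. The bound \<open>2 * (1 + 6 / \<epsilon>)\<close>
  comes from \<open>\<alpha>\<close> and \<open>\<beta>\<close> being at most
  \<open>2 * \<theta>\<close>.\<close>

lemma eventually_not_fast:
  assumes "0 < \<epsilon>" "\<epsilon> < 1"
  shows "\<forall>\<^sub>F \<theta> in at_top. \<forall>u \<ge> \<mu> \<theta> - C / \<theta>. \<not> (\<forall>t\<le>u. G t \<le> G u * exp (\<theta> * (1 + \<epsilon>) * (t - u)))"
proof -
  have "LIM N sequentially. exp (real N * \<epsilon>\<^sup>2 / 162 - \<epsilon> / 3 * C) :> at_top"
    using assms(1) by real_asymp
  then have "\<forall>\<^sub>F N in sequentially. 2 * (1 + 6 / \<epsilon>) < exp (real N * \<epsilon>\<^sup>2 / 162 - \<epsilon> / 3 * C)"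
    by (simp add: filterlim_at_top_dense)
  then obtain N :: nat where N: "2 * (1 + 6 / \<epsilon>) < exp (real N * \<epsilon>\<^sup>2 / 162 - \<epsilon> / 3 * C)"
    using eventually_happens'[OF sequentially_bot] by blast
  obtain T where T: "\<And>\<alpha> \<beta>. 0 < \<alpha> \<Longrightarrow> \<alpha> \<le> \<beta> \<Longrightarrow> T \<le> \<beta> \<Longrightarrow> real N * (2 * (\<beta> - \<alpha>) / (9 * \<beta>\<^sup>2)) \<le> \<mu> \<alpha> - \<mu> \<beta>"
    using curv[of N] by blast
  have "\<not> (\<forall>t\<le>u. G t \<le> G u * exp (\<theta> * (1 + \<epsilon>) * (t - u)))"
    if \<theta>: "0 < \<theta>" "T \<le> \<theta>" and u: "u \<ge> \<mu> \<theta> - C / \<theta>" for \<theta> u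
  proof
    assume G: "\<forall>t\<le>u. G t \<le> G u * exp (\<theta> * (1 + \<epsilon>) * (t - u))"
    define \<alpha> \<beta> where "\<alpha> = \<theta> * (1 + \<epsilon> / 3)" and "\<beta> = \<theta> * (1 + 2 * \<epsilon> / 3)"
    have ord: "0 < \<alpha>" "\<theta> < \<alpha>" "\<alpha> < \<beta>" "\<beta> < \<theta> * (1 + \<epsilon>)" "\<beta> \<le> 2 * \<theta>" "\<alpha> \<le> 2 * \<theta>"
      using assms \<theta> by (auto simp: \<alpha>_def \<beta>_def add_pos_pos)
    have d: "\<theta> * (1 + \<epsilon>) - \<beta> = \<epsilon> * \<theta> / 3" "\<beta> - \<alpha> = \<epsilon> * \<theta> / 3" "\<alpha> - \<theta> = \<epsilon> * \<theta> / 3"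
      by (auto simp: \<alpha>_def \<beta>_def algebra_simps)
    have "exp (\<beta> * u) * (L \<beta> / (2 * \<theta>)) \<le> exp (\<beta> * u) * (L \<beta> / \<beta>)"
      using ord L_pos[of \<beta>] \<theta> by (intro mult_left_mono divide_left_mono) auto
    also have "\<dots> \<le> (1 + \<alpha> / (\<theta> * (1 + \<epsilon>) - \<beta>)) * (exp (\<alpha> * u) * (L \<alpha> / \<alpha>))"
      using ord G by (intro laplace_compare_left[OF mono_G G_nonneg laplace]) auto
    also have "\<dots> \<le> (1 + 6 / \<epsilon>) * (exp (\<alpha> * u) * (L \<alpha> / \<theta>))"
    proof (rule mult_mono)
      have "\<alpha> / (\<theta> * (1 + \<epsilon>) - \<beta>) \<le> 2 * \<theta> / (\<epsilon> * \<theta> / 3)"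
        unfolding d(1) using ord \<theta> assms by (intro divide_right_mono) auto
      then show "1 + \<alpha> / (\<theta> * (1 + \<epsilon>) - \<beta>) \<le> 1 + 6 / \<epsilon>" using \<theta> assms by simp
      show "exp (\<alpha> * u) * (L \<alpha> / \<alpha>) \<le> exp (\<alpha> * u) * (L \<alpha> / \<theta>)"
        using ord L_pos[of \<alpha>] \<theta> by (intro mult_left_mono divide_left_mono) auto
    qed (use ord L_pos[of \<alpha>] assms in auto)
    finally have "exp (\<beta> * u) * L \<beta> \<le> 2 * (1 + 6 / \<epsilon>) * (exp (\<alpha> * u) * L \<alpha>)"
      using \<theta> by (simp add: field_simps)
    also have "\<dots> \<le> 2 * (1 + 6 / \<epsilon>) * (exp (\<alpha> * u) * (exp ((\<beta> - \<alpha>) * \<mu> \<alpha>) * L \<beta>))"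
      using L_le ord assms by (intro mult_left_mono) auto
    finally have "exp (\<beta> * u) * L \<beta> \<le> 2 * (1 + 6 / \<epsilon>) * exp (\<alpha> * u + (\<beta> - \<alpha>) * \<mu> \<alpha>) * L \<beta>"
      by (simp add: exp_add mult.assoc)
    then have "exp (\<beta> * u) \<le> 2 * (1 + 6 / \<epsilon>) * exp (\<alpha> * u + (\<beta> - \<alpha>) * \<mu> \<alpha>)"
      using L_pos[of \<beta>] ord by simp
    then have "exp (\<beta> * u) / exp (\<alpha> * u + (\<beta> - \<alpha>) * \<mu> \<alpha>) \<le> 2 * (1 + 6 / \<epsilon>)"
      by (simp add: pos_divide_le_eq)
    then have 1: "exp ((\<beta> - \<alpha>) * (u - \<mu> \<alpha>)) \<le> 2 * (1 + 6 / \<epsilon>)"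
      by (simp add: exp_diff[symmetric] algebra_simps)
    \<comment> \<open>\<open>curv\<close> has its larger argument, here \<open>\<alpha>\<close>, in
      the denominator; passing to \<open>\<theta>\<close> costs a factor 4.\<close>
    have "\<alpha>\<^sup>2 \<le> (2 * \<theta>)\<^sup>2" using ord by (intro power_mono) auto
    then have "real N * (2 * (\<alpha> - \<theta>) / (9 * (2 * \<theta>)\<^sup>2)) \<le> real N * (2 * (\<alpha> - \<theta>) / (9 * \<alpha>\<^sup>2))"
      using ord by (intro mult_left_mono divide_left_mono) auto
    then have "real N * (2 * (\<alpha> - \<theta>) / (9 * (2 * \<theta>)\<^sup>2)) - C / \<theta> \<le> u - \<mu> \<alpha>"
      using T[of \<theta> \<alpha>] \<theta> ord u by linarith
    then have "(\<beta> - \<alpha>) * (real N * (2 * (\<alpha> - \<theta>) / (9 * (2 * \<theta>)\<^sup>2)) - C / \<theta>) \<le> (\<beta> - \<alpha>) * (u - \<mu> \<alpha>)"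
      using ord by (intro mult_left_mono) auto
    also have "(\<beta> - \<alpha>) * (real N * (2 * (\<alpha> - \<theta>) / (9 * (2 * \<theta>)\<^sup>2)) - C / \<theta>) = real N * \<epsilon>\<^sup>2 / 162 - \<epsilon> / 3 * C"
      unfolding d using \<theta> by (simp add: field_simps power2_eq_square)
    finally have "exp (real N * \<epsilon>\<^sup>2 / 162 - \<epsilon> / 3 * C) \<le> exp ((\<beta> - \<alpha>) * (u - \<mu> \<alpha>))" by simp
    then show False using 1 N by linarith
  qed
  then show ?thesis
    by (intro eventually_mono[OF eventually_conj[OF eventually_gt_at_top[of 0] eventually_ge_at_top[of T]]]) blast
qed

text \<open>A chord too flat or too steep would extend, by \<open>log_concave_extrapolate\<close>,
  to one of the exponential bounds just excluded, once \<open>k\<close> is replaced by the threshold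
  rate.\<close>

lemma eventually_chord_slope:
  assumes "0 < \<epsilon>" "\<epsilon> < 1"
  shows "\<forall>\<^sub>F \<theta> in at_top. \<forall>u v k. 0 < u \<longrightarrow> u < v \<longrightarrow> \<mu> \<theta> - C / \<theta> \<le> u \<longrightarrow> v \<le> \<mu> \<theta> + C / \<theta> \<longrightarrow>
    G v = G u * exp (k * (v - u)) \<longrightarrow> \<theta> * (1 - \<epsilon>) \<le> k \<and> k \<le> \<theta> * (1 + \<epsilon>)"
  using eventually_not_slow[OF assms, of C] eventually_not_fast[OF assms, of C]
proof (eventually_elim, intro allI impI conjI)
  fix \<theta> u v k
  assume slow: "\<forall>v\<le>\<mu> \<theta> + C / \<theta>. \<not> (\<forall>t\<ge>v. G t \<le> G v * exp (\<theta> * (1 - \<epsilon>) * (t - v)))"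
    and fast: "\<forall>u\<ge>\<mu> \<theta> - C / \<theta>. \<not> (\<forall>t\<le>u. G t \<le> G u * exp (\<theta> * (1 + \<epsilon>) * (t - u)))"
    and uv: "0 < u" "u < v" "\<mu> \<theta> - C / \<theta> \<le> u" "v \<le> \<mu> \<theta> + C / \<theta>" "G v = G u * exp (k * (v - u))"
  have ex: "v \<le> t \<Longrightarrow> G t \<le> G v * exp (k * (t - v))" "t \<le> u \<Longrightarrow> G t \<le> G u * exp (k * (t - u))" for t
    by (rule log_concave_extrapolate[of G u v k t]; use lc G_pos G_nonneg uv in simp)+
  show "\<theta> * (1 - \<epsilon>) \<le> k"
  proof (rule ccontr)
    assume "\<not> \<theta> * (1 - \<epsilon>) \<le> k"
    then have "G t \<le> G v * exp (\<theta> * (1 - \<epsilon>) * (t - v))" if "v \<le> t" for t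
      using that by (intro order_trans[OF ex(1)[OF that]] mult_left_mono G_nonneg) (auto intro!: mult_right_mono)
    then show False using slow uv(4) by blast
  qed
  show "k \<le> \<theta> * (1 + \<epsilon>)"
  proof (rule ccontr)
    assume "\<not> k \<le> \<theta> * (1 + \<epsilon>)"
    then have "G t \<le> G u * exp (\<theta> * (1 + \<epsilon>) * (t - u))" if "t \<le> u" for t
      using that by (intro order_trans[OF ex(2)[OF that]] mult_left_mono G_nonneg) (auto intro!: mult_right_mono_neg)
    then show False using fast uv(3) by blast
  qed
qed

text \<open>For nonzero \<open>x\<close> the quotient is
  \<open>exp (K \<theta> / \<theta> * x)\<close>, where \<open>K \<theta>\<close> is the slope of
  the chord of \<open>ln G\<close> between the two arguments; \<open>eventually_chord_slope\<close>
  with \<open>C = \<bar>x\<bar>\<close> sends \<open>K \<theta> / \<theta>\<close> to 1.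
  \<open>growth\<close> keeps both arguments positive.\<close>

lemma ratio_tendsto_exp: "((\<lambda>\<theta>. G (\<mu> \<theta> + x / \<theta>) / G (\<mu> \<theta>)) \<longlongrightarrow> exp x) at_top"
proof (cases "x = 0")
  case True
  have "\<forall>\<^sub>F \<theta> in at_top. 0 < \<theta> * \<mu> \<theta>" using growth by (simp add: filterlim_at_top_dense)
  then have "\<forall>\<^sub>F \<theta> in at_top. G (\<mu> \<theta> + x / \<theta>) / G (\<mu> \<theta>) = exp x"
    using eventually_gt_at_top[of 0]
  proof eventually_elim
    case (elim \<theta>)
    then have "0 < G (\<mu> \<theta>)" by (intro G_pos) (simp add: zero_less_mult_iff)
    then show ?case using True by simp
  qed
  then show ?thesis by (rule tendsto_eventually)
next
  case False
  define K where "K \<theta> = \<theta> * ln (G (\<mu> \<theta> + x / \<theta>) / G (\<mu> \<theta>)) / x" for \<theta>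
  have ev: "\<forall>\<^sub>F \<theta> in at_top. 0 < \<theta> \<and> 0 < \<mu> \<theta> \<and> 0 < \<mu> \<theta> + x / \<theta>"
  proof -
    have "\<forall>\<^sub>F \<theta> in at_top. \<bar>x\<bar> < \<theta> * \<mu> \<theta>" using growth by (simp add: filterlim_at_top_dense)
    then show ?thesis using eventually_gt_at_top[of 0]
    proof eventually_elim
      case (elim \<theta>)
      then have "0 < \<theta> * \<mu> \<theta>" "0 < \<theta> * \<mu> \<theta> + x" by linarith+
      then have "0 < \<mu> \<theta>" "0 < (\<theta> * \<mu> \<theta> + x) / \<theta>" using elim by (auto simp: zero_less_mult_iff)
      then show ?case using elim by (simp add: add_divide_distrib)
    qed
  qed
  have "((\<lambda>\<theta>. K \<theta> / \<theta>) \<longlongrightarrow> 1) at_top"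
  proof (rule tendstoI)
    fix e :: real assume e: "0 < e"
    define \<epsilon> where "\<epsilon> = min (e / 2) (1 / 2)"
    have \<epsilon>: "0 < \<epsilon>" "\<epsilon> < 1" "\<epsilon> < e" using e by (auto simp: \<epsilon>_def)
    from eventually_chord_slope[OF \<epsilon>(1,2), of "\<bar>x\<bar>"] ev
    show "\<forall>\<^sub>F \<theta> in at_top. dist (K \<theta> / \<theta>) 1 < e"
    proof eventually_elim
      case (elim \<theta>)
      let ?s = "\<mu> \<theta>" and ?p = "\<mu> \<theta> + x / \<theta>"
      have pos: "0 < G ?s" "0 < G ?p" using elim G_pos by auto
      have K: "K \<theta> * (x / \<theta>) = ln (G ?p / G ?s)" using elim False by (simp add: K_def)
      have "\<theta> * (1 - \<epsilon>) \<le> K \<theta> \<and> K \<theta> \<le> \<theta> * (1 + \<epsilon>)"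
      proof (cases "0 < x")
        case True
        have "G ?p = G ?s * exp (K \<theta> * (?p - ?s))" using pos K by simp
        then show ?thesis using elim True by (elim conjE allE[of _ ?s] allE[of _ ?p] allE[of _ "K \<theta>"]) auto
      next
        case neg: False
        have "K \<theta> * (?s - ?p) = - ln (G ?p / G ?s)" using K by simp
        then have "G ?s = G ?p * exp (K \<theta> * (?s - ?p))" using pos by (simp add: exp_minus)
        moreover have "x / \<theta> < 0" using neg False elim by (simp add: divide_neg_pos)
        ultimately show ?thesis using elim neg by (elim conjE allE[of _ ?p] allE[of _ ?s] allE[of _ "K \<theta>"]) auto
      qed
      then have "1 - \<epsilon> \<le> K \<theta> / \<theta>" "K \<theta> / \<theta> \<le> 1 + \<epsilon>" using elim by (auto simp: pos_le_divide_eq pos_divide_le_eq mult.commute)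
      then show ?case using \<epsilon>(3) by (simp add: dist_real_def abs_less_iff)
    qed
  qed
  then have "((\<lambda>\<theta>. exp (K \<theta> / \<theta> * x)) \<longlongrightarrow> exp (1 * x)) at_top" by (intro tendsto_intros)
  then have "((\<lambda>\<theta>. exp (K \<theta> / \<theta> * x)) \<longlongrightarrow> exp x) at_top" by simp
  moreover have "\<forall>\<^sub>F \<theta> in at_top. exp (K \<theta> / \<theta> * x) = G (\<mu> \<theta> + x / \<theta>) / G (\<mu> \<theta>)"
    using ev by eventually_elim (use False G_pos in \<open>simp add: K_def\<close>)
  ultimately show ?thesis by (rule Lim_transform_eventually)
qed

end

section \<open>Gaussian quadratic series\<close>

text \<open>The integrand is \<open>\<sigma>\<close> times the centred normal density of variance
  \<open>1 / (1 + 2 * \<theta>)\<close>.\<close>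

lemma gaussian_laplace_square:
  assumes "0 \<le> \<theta>"
  shows "(\<integral>y. std_normal_density y * exp (- \<theta> * y\<^sup>2) \<partial>lborel) = 1 / sqrt (1 + 2 * \<theta>)"
proof -
  define \<sigma> where "\<sigma> = 1 / sqrt (1 + 2 * \<theta>)"
  have \<sigma>: "0 < \<sigma>" "\<sigma>\<^sup>2 = 1 / (1 + 2 * \<theta>)" using assms by (auto simp: \<sigma>_def power_divide)
  have "std_normal_density y * exp (- \<theta> * y\<^sup>2) = \<sigma> * normal_density 0 \<sigma> y" for y
  proof -
    have "- y\<^sup>2 / 2 + - \<theta> * y\<^sup>2 = - (y - 0)\<^sup>2 / (2 * \<sigma>\<^sup>2)"
      unfolding \<sigma>(2) using assms by (simp add: field_simps)
    then have e: "exp (- y\<^sup>2 / 2) * exp (- \<theta> * y\<^sup>2) = exp (- (y - 0)\<^sup>2 / (2 * \<sigma>\<^sup>2))"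
      by (simp only: exp_add[symmetric])
    have "sqrt (2 * pi * \<sigma>\<^sup>2) = sqrt (2 * pi) * \<sigma>" using \<sigma>(1) by (simp add: real_sqrt_mult)
    then show ?thesis
      unfolding std_normal_density_def normal_density_def using e \<sigma>(1) by simp
  qed
  then have "(\<integral>y. std_normal_density y * exp (- \<theta> * y\<^sup>2) \<partial>lborel) = (\<integral>y. \<sigma> * normal_density 0 \<sigma> y \<partial>lborel)" by simp
  also have "\<dots> = \<sigma>" using \<sigma>(1) by simp
  finally show ?thesis by (simp add: \<sigma>_def)
qed

text \<open>Tangent bounds for \<open>- ln (1 + 2 * c * \<theta>) / 2\<close>, whose derivative is
  \<open>- c / (1 + 2 * c * \<theta>)\<close>: the share of one summand in \<open>L_ge\<close> and
  \<open>L_le\<close>. Each is one use of \<open>1 + y \<le> exp y\<close>.\<close>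

lemma inverse_sqrt_ratio_bounds:
  fixes c \<alpha> \<beta> :: real
  assumes "0 < c" "0 \<le> \<alpha>" "\<alpha> \<le> \<beta>"
  shows "exp ((\<beta> - \<alpha>) * (c / (1 + 2 * c * \<beta>))) * (1 / sqrt (1 + 2 * c * \<beta>)) \<le> 1 / sqrt (1 + 2 * c * \<alpha>)"
    and "1 / sqrt (1 + 2 * c * \<alpha>) \<le> exp ((\<beta> - \<alpha>) * (c / (1 + 2 * c * \<alpha>))) * (1 / sqrt (1 + 2 * c * \<beta>))"
proof -
  define A B where "A = 1 + 2 * c * \<alpha>" and "B = 1 + 2 * c * \<beta>"
  have "1 \<le> A" "A \<le> B" using assms by (auto simp: A_def B_def)
  then have pos: "0 < A" "0 < B" by auto
  have d: "(\<beta> - \<alpha>) * (c / D) = (B - A) / D / 2" for D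
  proof -
    have "B - A = 2 * ((\<beta> - \<alpha>) * c)" by (simp add: A_def B_def algebra_simps)
    then show ?thesis by simp
  qed
  have sq: "(exp (y / 2))\<^sup>2 = exp y" for y :: real using exp_double[of "y / 2"] by simp
  have "A / B = 1 + - ((B - A) / B)" using pos by (simp add: field_simps)
  also have "\<dots> \<le> exp (- ((B - A) / B))" by (rule exp_ge_add_one_self)
  finally have "exp ((B - A) / B) \<le> B / A" using pos by (simp add: exp_minus field_simps)
  then have "exp ((B - A) / B / 2) \<le> sqrt (B / A)"
    by (intro real_le_rsqrt) (simp only: sq)
  then show "exp ((\<beta> - \<alpha>) * (c / (1 + 2 * c * \<beta>))) * (1 / sqrt (1 + 2 * c * \<beta>)) \<le> 1 / sqrt (1 + 2 * c * \<alpha>)"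
    using pos unfolding d A_def[symmetric] B_def[symmetric] by (simp add: real_sqrt_divide field_simps)
  have "B / A = 1 + (B - A) / A" using pos by (simp add: field_simps)
  also have "\<dots> \<le> exp ((B - A) / A)" by (rule exp_ge_add_one_self)
  finally have "sqrt (B / A) \<le> exp ((B - A) / A / 2)"
    by (intro real_le_lsqrt) (simp_all only: sq exp_ge_zero)
  then show "1 / sqrt (1 + 2 * c * \<alpha>) \<le> exp ((\<beta> - \<alpha>) * (c / (1 + 2 * c * \<alpha>))) * (1 / sqrt (1 + 2 * c * \<beta>))"
    using pos unfolding d A_def[symmetric] B_def[symmetric] by (simp add: real_sqrt_divide field_simps)
qed

section \<open>Distribution functions of weighted sums of Gaussian squares\<close>

locale gaussian_quadratic_series = prob_space M for M :: "'a measure" +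
  fixes x :: "nat \<Rightarrow> 'a \<Rightarrow> real" and c :: "nat \<Rightarrow> real"
  assumes indep: "indep_vars (\<lambda>_. borel) x UNIV"
    and dist: "\<And>i. distributed M lborel (x i) std_normal_density"
    and c_pos: "\<And>i. 0 < c i" and c_summable: "summable c"
begin

definition S :: "nat \<Rightarrow> 'a \<Rightarrow> real" where "S n \<omega> = (\<Sum>i<n. c i * (x i \<omega>)\<^sup>2)"
definition Z :: "'a \<Rightarrow> real" where "Z \<omega> = (\<Sum>i. c i * (x i \<omega>)\<^sup>2)"
text \<open>The weak inequality suits right-continuity and the passage to the limit in
  \<open>n\<close>; the strict one of the theorem is recovered in
  \<open>prob_Z_less\<close>.\<close>

definition S_cdf :: "nat \<Rightarrow> real \<Rightarrow> real" where "S_cdf n s = \<P>(\<omega> in M. S n \<omega> \<le> s)"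
definition Z_cdf :: "real \<Rightarrow> real" where "Z_cdf s = \<P>(\<omega> in M. Z \<omega> \<le> s)"
definition L :: "real \<Rightarrow> real" where "L \<theta> = expectation (\<lambda>\<omega>. exp (- \<theta> * Z \<omega>))"
text \<open>With \<open>c i = 1 / (a i)\<^sup>2\<close> the terms are
  \<open>1 / ((a i)\<^sup>2 + 2 * \<theta>)\<close>. For positive \<open>\<theta>\<close> this is
  minus the logarithmic derivative of \<open>L\<close>.\<close>

definition \<mu> :: "real \<Rightarrow> real" where "\<mu> \<theta> = (\<Sum>i. c i / (1 + 2 * c i * \<theta>))"

lemma x_measurable [measurable]: "x i \<in> borel_measurable M"
  using distributed_measurable[OF dist[of i]] by simp

lemma S_measurable [measurable]: "S n \<in> borel_measurable M"
  unfolding S_def[abs_def] by measurable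

lemma Z_measurable [measurable]: "Z \<in> borel_measurable M"
  unfolding Z_def[abs_def] by measurable

lemma S_nonneg: "0 \<le> S n \<omega>"
  unfolding S_def using c_pos by (intro sum_nonneg) (simp add: less_imp_le)

lemma S_cdf_props: "mono (S_cdf n)" "0 \<le> S_cdf n s" "S_cdf n s \<le> 1" "s < 0 \<Longrightarrow> S_cdf n s = 0"
proof -
  show "mono (S_cdf n)" unfolding S_cdf_def by (intro monoI finite_measure_mono) auto
  show "S_cdf n s = 0" if "s < 0"
  proof -
    have "{\<omega> \<in> space M. S n \<omega> \<le> s} = {}" using S_nonneg[of n] that by (auto simp: not_le intro: order.strict_trans2)
    then show ?thesis unfolding S_cdf_def by (simp only: measure_empty)
  qed
qed (auto simp: S_cdf_def)

text \<open>The new summand is independent of \<open>S n\<close>, so the pair has a product law.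
  Slicing the half-plane \<open>?A\<close> averages \<open>S_cdf n (s - u)\<close> over the law of
  that summand, which the density of \<open>x n\<close> makes explicit.\<close>

lemma S_cdf_Suc: "S_cdf (Suc n) s = (\<integral>y. std_normal_density y * S_cdf n (s - c n * y\<^sup>2) \<partial>lborel)"
proof -
  define Y where "Y i \<omega> = c i * (x i \<omega>)\<^sup>2" for i \<omega>
  have [measurable]: "Y i \<in> borel_measurable M" for i unfolding Y_def by measurable
  have [measurable]: "S_cdf n \<in> borel_measurable borel" using S_cdf_props(1) by (rule borel_measurable_mono)
  have "indep_vars (\<lambda>_. borel) Y (insert n {..<n})"
    unfolding Y_def by (rule indep_vars_compose2[OF indep_vars_subset[OF indep]]) auto
  from indep_vars_sum[OF _ _ this]
  have ind: "indep_var borel (Y n) borel (S n)" by (simp add: Y_def S_def[abs_def])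
  then have pair: "distr M borel (Y n) \<Otimes>\<^sub>M distr M borel (S n) = distr M (borel \<Otimes>\<^sub>M borel) (\<lambda>\<omega>. (Y n \<omega>, S n \<omega>))"
    by (simp add: indep_var_distribution_eq)
  interpret D: prob_space "distr M borel (S n)" by (rule prob_space_distr) simp
  let ?A = "{p. fst p + snd p \<le> s} :: (real \<times> real) set"
  have "?A = {p \<in> space (borel \<Otimes>\<^sub>M borel). fst p + snd p \<le> s}" by (simp add: space_pair_measure)
  also have "\<dots> \<in> sets (borel \<Otimes>\<^sub>M borel)" by measurable
  finally have A: "?A \<in> sets (borel \<Otimes>\<^sub>M borel)" .
  have "ennreal (S_cdf (Suc n) s) = emeasure M {\<omega> \<in> space M. Y n \<omega> + S n \<omega> \<le> s}"
    by (simp add: S_cdf_def S_def Y_def emeasure_eq_measure add.commute)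
  also have "\<dots> = emeasure (distr M (borel \<Otimes>\<^sub>M borel) (\<lambda>\<omega>. (Y n \<omega>, S n \<omega>))) ?A"
    using A by (subst emeasure_distr) (auto intro!: arg_cong[where f="emeasure M"])
  also have "\<dots> = (\<integral>\<^sup>+u. emeasure (distr M borel (S n)) (Pair u -` ?A) \<partial>distr M borel (Y n))"
    unfolding pair[symmetric] using A by (intro D.emeasure_pair_measure_alt) simp
  also have "\<dots> = (\<integral>\<^sup>+u. ennreal (S_cdf n (s - u)) \<partial>distr M borel (Y n))"
  proof (rule nn_integral_cong)
    fix u
    have "emeasure (distr M borel (S n)) (Pair u -` ?A) = emeasure M {\<omega> \<in> space M. S n \<omega> \<le> s - u}"
      by (subst emeasure_distr) (auto intro!: arg_cong[where f="emeasure M"] simp: algebra_simps)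
    then show "emeasure (distr M borel (S n)) (Pair u -` ?A) = ennreal (S_cdf n (s - u))"
      by (simp add: S_cdf_def emeasure_eq_measure)
  qed
  also have "\<dots> = (\<integral>\<^sup>+\<omega>. ennreal (S_cdf n (s - Y n \<omega>)) \<partial>M)"
    by (subst nn_integral_distr) auto
  also have "\<dots> = ennreal (expectation (\<lambda>\<omega>. S_cdf n (s - Y n \<omega>)))"
    by (rule nn_integral_eq_integral, rule integrable_const_bound[where B=1]) (auto simp: S_cdf_props)
  also have "expectation (\<lambda>\<omega>. S_cdf n (s - Y n \<omega>)) = (\<integral>y. std_normal_density y * S_cdf n (s - c n * y\<^sup>2) \<partial>lborel)"
    unfolding Y_def by (rule distributed_integral[OF dist, symmetric]) auto
  finally show ?thesis
    by (subst (asm) ennreal_inj) (auto simp: S_cdf_props intro!: integral_nonneg_AE)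
qed

lemma log_concave_S_cdf: "log_concave (S_cdf n)"
proof (induction n)
  case 0
  \<comment> \<open>The empty sum gives the indicator of a half-line, which is log-concave by
    convexity.\<close>
  have "S_cdf 0 s = (if 0 \<le> s then 1 else 0)" for s by (simp add: S_cdf_def S_def prob_space)
  then show ?case by (auto simp: log_concave_def)
next
  case (Suc n)
  show ?case unfolding S_cdf_Suc[abs_def]
    by (rule log_concave_gaussian_average[OF _ _ _ _ Suc c_pos]) (use S_cdf_props in auto)
qed

text \<open>Each square has expectation 1, so the series has the finite expectation
  \<open>suminf c\<close>. Hence \<open>Z\<close> takes an unspecified value of a divergent
  \<open>suminf\<close> only on a null set.\<close>

lemma AE_summable: "AE \<omega> in M. summable (\<lambda>i. c i * (x i \<omega>)\<^sup>2)"
proof -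
  have x2: "(\<integral>\<^sup>+\<omega>. ennreal ((x i \<omega>)\<^sup>2) \<partial>M) = 1" for i
  proof -
    have "has_bochner_integral lborel (\<lambda>y. std_normal_density y * y\<^sup>2) 1"
      using std_normal_moment_even[of 1] by simp
    then have "(\<integral>\<^sup>+y. ennreal (std_normal_density y * y\<^sup>2) \<partial>lborel) = 1"
      by (subst nn_integral_eq_integral) (auto simp: has_bochner_integral_iff)
    then show ?thesis
      by (subst distributed_nn_integral[OF dist, symmetric]) (auto simp: ennreal_mult')
  qed
  have "(\<integral>\<^sup>+\<omega>. (\<Sum>i. ennreal (c i * (x i \<omega>)\<^sup>2)) \<partial>M) = (\<Sum>i. (\<integral>\<^sup>+\<omega>. ennreal (c i * (x i \<omega>)\<^sup>2) \<partial>M))"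
    by (rule nn_integral_suminf) simp
  also have "\<dots> = (\<Sum>i. ennreal (c i))"
    using c_pos by (simp add: ennreal_mult' less_imp_le nn_integral_cmult x2)
  also have "\<dots> = ennreal (suminf c)"
    using c_pos c_summable by (intro suminf_ennreal_eq) (auto simp: less_imp_le summable_sums)
  finally have "(\<integral>\<^sup>+\<omega>. (\<Sum>i. ennreal (c i * (x i \<omega>)\<^sup>2)) \<partial>M) \<noteq> \<infinity>" by simp
  then have "AE \<omega> in M. (\<Sum>i. ennreal (c i * (x i \<omega>)\<^sup>2)) \<noteq> \<infinity>"
    by (rule nn_integral_PInf_AE[rotated]) simp
  then show ?thesis
    by eventually_elim (rule summable_suminf_not_top, use c_pos in \<open>auto simp: less_imp_le\<close>)
qed

lemma AE_S_tendsto: "AE \<omega> in M. (\<lambda>n. S n \<omega>) \<longlonglongrightarrow> Z \<omega>"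
  using AE_summable by eventually_elim (unfold S_def Z_def, rule summable_LIMSEQ)

lemma AE_S_le_Z: "AE \<omega> in M. \<forall>n. S n \<omega> \<le> Z \<omega>"
  using AE_summable by eventually_elim (unfold S_def Z_def, use c_pos in \<open>auto simp: less_imp_le intro!: sum_le_suminf\<close>)

lemma AE_Z_nonneg: "AE \<omega> in M. 0 \<le> Z \<omega>"
  using AE_S_le_Z by eventually_elim (auto intro: order_trans[OF S_nonneg])

text \<open>Almost surely the partial sums increase to \<open>Z\<close>, so \<open>Z \<le> s\<close>
  holds exactly when every \<open>S n \<le> s\<close>. The indicators therefore converge at every
  \<open>s\<close>, even on the event \<open>Z = s\<close>.\<close>

lemma S_cdf_tendsto: "(\<lambda>n. S_cdf n s) \<longlonglongrightarrow> Z_cdf s"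
proof -
  have "(\<lambda>n. expectation (indicator {\<omega> \<in> space M. S n \<omega> \<le> s})) \<longlonglongrightarrow> (expectation (indicator {\<omega> \<in> space M. Z \<omega> \<le> s}) :: real)"
  proof (rule integral_dominated_convergence[where w="\<lambda>_. 1"])
    show "AE \<omega> in M. (\<lambda>n. indicator {\<omega> \<in> space M. S n \<omega> \<le> s} \<omega> :: real) \<longlonglongrightarrow> indicator {\<omega> \<in> space M. Z \<omega> \<le> s} \<omega>"
      using AE_S_tendsto AE_S_le_Z
    proof eventually_elim
      case (elim \<omega>)
      show ?case
      proof (cases "Z \<omega> \<le> s")
        case True
        then have "S n \<omega> \<le> s" for n using elim(2) order_trans by blast
        then show ?thesis using True by (simp add: indicator_def)
      next
        case False
        then have "\<forall>\<^sub>F n in sequentially. s < S n \<omega>" using elim(1) by (intro order_tendstoD(1)) auto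
        then have "\<forall>\<^sub>F n in sequentially. indicator {\<omega> \<in> space M. S n \<omega> \<le> s} \<omega> = (indicator {\<omega> \<in> space M. Z \<omega> \<le> s} \<omega> :: real)"
          by eventually_elim (use False in \<open>auto simp: indicator_def\<close>)
        then show ?thesis by (rule tendsto_eventually)
      qed
    qed
  qed (auto simp: indicator_def)
  then show ?thesis by (simp add: S_cdf_def Z_cdf_def Collect_conj_eq)
qed

lemma Z_cdf_props: "mono Z_cdf" "0 \<le> Z_cdf s" "Z_cdf s \<le> 1"
  unfolding Z_cdf_def by (auto intro!: monoI finite_measure_mono)

lemma log_concave_Z_cdf: "log_concave Z_cdf"
  unfolding log_concave_def
proof (intro allI impI)
  fix l s t :: real assume l: "0 < l" "l < 1"
  show "Z_cdf s powr l * Z_cdf t powr (1 - l) \<le> Z_cdf (l * s + (1 - l) * t)"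
  proof (rule LIMSEQ_le)
    show "(\<lambda>n. S_cdf n s powr l * S_cdf n t powr (1 - l)) \<longlonglongrightarrow> Z_cdf s powr l * Z_cdf t powr (1 - l)"
      \<comment> \<open>The limits may be 0; \<open>powr\<close> is still continuous there along
        nonnegative sequences because the exponents are positive.\<close>
      using l S_cdf_props(2) by (intro tendsto_mult tendsto_powr' S_cdf_tendsto tendsto_const) auto
    show "\<exists>N. \<forall>n\<ge>N. S_cdf n s powr l * S_cdf n t powr (1 - l) \<le> S_cdf n (l * s + (1 - l) * t)"
      using log_concave_S_cdf l by (auto simp: log_concave_def)
  qed (rule S_cdf_tendsto)
qed

section \<open>The Laplace transform of the series and the function \<open>\<mu>\<close>\<close>

lemma expectation_exp_S:
  assumes "0 \<le> \<theta>"
  shows "expectation (\<lambda>\<omega>. exp (- \<theta> * S n \<omega>)) = (\<Prod>i<n. 1 / sqrt (1 + 2 * c i * \<theta>))"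
proof -
  have "expectation (\<lambda>\<omega>. exp (- \<theta> * S n \<omega>)) = expectation (\<lambda>\<omega>. \<Prod>i<n. exp (- (\<theta> * c i) * (x i \<omega>)\<^sup>2))"
    by (simp add: S_def sum_distrib_left exp_sum sum_negf[symmetric] mult.assoc)
  also have "\<dots> = (\<Prod>i<n. expectation (\<lambda>\<omega>. exp (- (\<theta> * c i) * (x i \<omega>)\<^sup>2)))"
  proof (rule indep_vars_lebesgue_integral)
    show "indep_vars (\<lambda>_. borel) (\<lambda>i \<omega>. exp (- (\<theta> * c i) * (x i \<omega>)\<^sup>2)) {..<n}"
      by (rule indep_vars_compose2[OF indep_vars_subset[OF indep]]) auto
    show "integrable M (\<lambda>\<omega>. exp (- (\<theta> * c i) * (x i \<omega>)\<^sup>2))" for i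
      using assms c_pos[of i] by (intro integrable_const_bound[where B=1]) auto
  qed simp
  also have "\<dots> = (\<Prod>i<n. 1 / sqrt (1 + 2 * c i * \<theta>))"
  proof (rule prod.cong[OF refl])
    fix i
    have "expectation (\<lambda>\<omega>. exp (- (\<theta> * c i) * (x i \<omega>)\<^sup>2)) = (\<integral>y. std_normal_density y * exp (- (\<theta> * c i) * y\<^sup>2) \<partial>lborel)"
      by (rule distributed_integral[OF dist, symmetric]) auto
    also have "\<dots> = 1 / sqrt (1 + 2 * (\<theta> * c i))" using assms c_pos[of i] by (intro gaussian_laplace_square) simp
    finally show "expectation (\<lambda>\<omega>. exp (- (\<theta> * c i) * (x i \<omega>)\<^sup>2)) = 1 / sqrt (1 + 2 * c i * \<theta>)"
      by (simp add: mult_ac)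
  qed
  finally show ?thesis .
qed

lemma integrable_exp_Z: "0 \<le> \<theta> \<Longrightarrow> integrable M (\<lambda>\<omega>. exp (- \<theta> * Z \<omega>))"
  using AE_Z_nonneg by (intro integrable_const_bound[where B=1]) (auto elim!: eventually_mono)

lemma L_tendsto:
  assumes "0 \<le> \<theta>"
  shows "(\<lambda>n. \<Prod>i<n. 1 / sqrt (1 + 2 * c i * \<theta>)) \<longlonglongrightarrow> L \<theta>"
  unfolding expectation_exp_S[OF assms, symmetric] L_def
proof (rule integral_dominated_convergence[where w="\<lambda>_. 1"])
  show "AE \<omega> in M. (\<lambda>n. exp (- \<theta> * S n \<omega>)) \<longlonglongrightarrow> exp (- \<theta> * Z \<omega>)"
    using AE_S_tendsto by eventually_elim (intro tendsto_intros)
  show "AE \<omega> in M. norm (exp (- \<theta> * S n \<omega>)) \<le> 1" for n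
    using S_nonneg assms by simp
qed auto

lemma L_pos: "0 < L \<theta>" if "0 \<le> \<theta>"
proof -
  have "L \<theta> \<noteq> 0"
  proof
    assume "L \<theta> = 0"
    then have "AE \<omega> in M. exp (- \<theta> * Z \<omega>) = 0"
      unfolding L_def by (subst (asm) integral_nonneg_eq_0_iff_AE) (use integrable_exp_Z[OF that] in auto)
    then have "AE \<omega> in M. False" by simp
    then show False by simp
  qed
  moreover have "0 \<le> L \<theta>" unfolding L_def by simp
  ultimately show ?thesis by simp
qed

lemma summable_mu: "0 \<le> \<theta> \<Longrightarrow> summable (\<lambda>i. c i / (1 + 2 * c i * \<theta>))"
proof (rule summable_comparison_test'[OF c_summable])
  fix i assume \<theta>: "0 \<le> \<theta>"
  then have "c i / (1 + 2 * c i * \<theta>) \<le> c i / 1" using c_pos[of i] by (intro divide_left_mono) (auto intro: add_pos_nonneg)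
  then show "norm (c i / (1 + 2 * c i * \<theta>)) \<le> c i" using c_pos[of i] \<theta> by simp
qed

text \<open>The bounds for single factors are multiplied over \<open>i < n\<close>, where their
  exponents add up to partial sums of \<open>\<mu>\<close>; then \<open>n\<close> tends to
  infinity.\<close>

lemma L_ratio:
  assumes "0 \<le> \<alpha>" "\<alpha> \<le> \<beta>"
  shows "exp ((\<beta> - \<alpha>) * \<mu> \<beta>) * L \<beta> \<le> L \<alpha>" and "L \<alpha> \<le> exp ((\<beta> - \<alpha>) * \<mu> \<alpha>) * L \<beta>"
proof -
  have lim: "(\<lambda>n. exp ((\<beta> - \<alpha>) * (\<Sum>i<n. c i / (1 + 2 * c i * \<theta>))) * (\<Prod>i<n. 1 / sqrt (1 + 2 * c i * \<beta>))) \<longlonglongrightarrow> exp ((\<beta> - \<alpha>) * \<mu> \<theta>) * L \<beta>"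
    if "0 \<le> \<theta>" for \<theta>
    unfolding \<mu>_def using assms by (intro tendsto_intros summable_LIMSEQ summable_mu L_tendsto that) simp
  have eq: "exp ((\<beta> - \<alpha>) * (\<Sum>i<n. c i / (1 + 2 * c i * \<theta>))) * (\<Prod>i<n. 1 / sqrt (1 + 2 * c i * \<beta>))
      = (\<Prod>i<n. exp ((\<beta> - \<alpha>) * (c i / (1 + 2 * c i * \<theta>))) * (1 / sqrt (1 + 2 * c i * \<beta>)))" for n \<theta>
    by (simp only: sum_distrib_left exp_sum[OF finite_lessThan] prod.distrib)
  have pos: "0 \<le> 1 + 2 * c i * \<beta>" for i using assms c_pos[of i] by (auto intro!: add_nonneg_nonneg simp: less_imp_le)
  show "exp ((\<beta> - \<alpha>) * \<mu> \<beta>) * L \<beta> \<le> L \<alpha>"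
  proof (rule LIMSEQ_le[OF lim L_tendsto], goal_cases)
    case 3
    show ?case unfolding eq using assms c_pos pos
      by (intro exI allI impI prod_mono conjI inverse_sqrt_ratio_bounds) auto
  qed (use assms in auto)
  show "L \<alpha> \<le> exp ((\<beta> - \<alpha>) * \<mu> \<alpha>) * L \<beta>"
  proof (rule LIMSEQ_le[OF L_tendsto lim], goal_cases)
    case 3
    have "0 \<le> 1 + 2 * c i * \<alpha>" for i using assms c_pos[of i] by (auto intro!: add_nonneg_nonneg simp: less_imp_le)
    then show ?case unfolding eq using assms c_pos
      by (intro exI allI impI prod_mono conjI inverse_sqrt_ratio_bounds) auto
  qed (use assms in auto)
qed

text \<open>All terms of \<open>\<mu> \<alpha> - \<mu> \<beta>\<close> are nonnegative, and for
  large \<open>\<beta>\<close> each of the first \<open>N\<close> has the stated order. Since there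
  are infinitely many summands, \<open>N\<close> is arbitrary.\<close>

lemma mu_curvature:
  "\<exists>T. \<forall>\<alpha> \<beta>. 0 < \<alpha> \<longrightarrow> \<alpha> \<le> \<beta> \<longrightarrow> T \<le> \<beta> \<longrightarrow> real N * (2 * (\<beta> - \<alpha>) / (9 * \<beta>\<^sup>2)) \<le> \<mu> \<alpha> - \<mu> \<beta>"
proof (intro exI allI impI)
  \<comment> \<open>The last assumption fixes the witness for \<open>T\<close>: the sum is at least
    each \<open>1 / c i\<close> with \<open>i < N\<close>, so it forces
    \<open>1 \<le> c i * \<beta>\<close>.\<close>
  fix \<alpha> \<beta> :: real assume ab: "0 < \<alpha>" "\<alpha> \<le> \<beta>" and T: "(\<Sum>i<N. 1 / c i) \<le> \<beta>"
  define d where "d i = c i / (1 + 2 * c i * \<alpha>) - c i / (1 + 2 * c i * \<beta>)" for i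
  have pos: "0 < 1 + 2 * c i * \<alpha>" "0 < 1 + 2 * c i * \<beta>" for i
    using ab c_pos[of i] by (auto intro!: add_pos_pos)
  have d: "d i = 2 * (c i)\<^sup>2 * (\<beta> - \<alpha>) / ((1 + 2 * c i * \<alpha>) * (1 + 2 * c i * \<beta>))" for i
    unfolding d_def using pos[of i] by (simp add: diff_frac_eq power2_eq_square) (simp add: algebra_simps)
  have d0: "0 \<le> d i" for i unfolding d using pos[of i] ab by simp
  have dN: "2 * (\<beta> - \<alpha>) / (9 * \<beta>\<^sup>2) \<le> d i" if "i < N" for i
  proof -
    have "1 / c i \<le> (\<Sum>i<N. 1 / c i)" using that c_pos by (intro member_le_sum) (auto simp: less_imp_le)
    also note T
    finally have 1: "1 \<le> c i * \<beta>" using c_pos[of i] by (simp add: divide_le_eq mult.commute)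
    have "(1 + 2 * c i * \<alpha>) * (1 + 2 * c i * \<beta>) \<le> (3 * (c i * \<beta>)) * (3 * (c i * \<beta>))"
    proof (rule mult_mono)
      have "c i * \<alpha> \<le> c i * \<beta>" using ab c_pos[of i] by simp
      then show "1 + 2 * c i * \<alpha> \<le> 3 * (c i * \<beta>)" using 1 by linarith
    qed (use 1 pos[of i] in \<open>auto simp: mult.commute\<close>)
    then have "2 * (c i)\<^sup>2 * (\<beta> - \<alpha>) / ((3 * (c i * \<beta>)) * (3 * (c i * \<beta>))) \<le> d i"
      unfolding d using pos[of i] ab c_pos[of i] by (intro divide_left_mono) auto
    also have "2 * (c i)\<^sup>2 * (\<beta> - \<alpha>) / ((3 * (c i * \<beta>)) * (3 * (c i * \<beta>))) = 2 * (\<beta> - \<alpha>) / (9 * \<beta>\<^sup>2)"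
      using c_pos[of i] ab by (simp add: power2_eq_square)
    finally show ?thesis .
  qed
  have "real N * (2 * (\<beta> - \<alpha>) / (9 * \<beta>\<^sup>2)) = (\<Sum>i<N. 2 * (\<beta> - \<alpha>) / (9 * \<beta>\<^sup>2))" by simp
  also have "\<dots> \<le> (\<Sum>i<N. d i)" by (intro sum_mono dN) simp
  also have "\<dots> \<le> (\<Sum>i. d i)"
    unfolding d_def using ab d0 by (intro sum_le_suminf summable_diff summable_mu) (auto simp: d_def)
  also have "\<dots> = \<mu> \<alpha> - \<mu> \<beta>"
    unfolding \<mu>_def d_def using ab by (intro suminf_diff[symmetric] summable_mu) auto
  finally show "real N * (2 * (\<beta> - \<alpha>) / (9 * \<beta>\<^sup>2)) \<le> \<mu> \<alpha> - \<mu> \<beta>" .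
qed

text \<open>Once \<open>1 \<le> c i * \<theta>\<close>, the term of index \<open>i\<close>
  contributes at least \<open>1 / 3\<close> to \<open>\<theta> * \<mu> \<theta>\<close>, so the
  first \<open>N\<close> terms give \<open>N / 3\<close>.\<close>

lemma mu_growth: "LIM \<theta> at_top. \<theta> * \<mu> \<theta> :> at_top"
  unfolding filterlim_at_top
proof
  fix K :: real
  obtain N :: nat where N: "3 * K \<le> real N" using real_arch_simple by blast
  show "\<forall>\<^sub>F \<theta> in at_top. K \<le> \<theta> * \<mu> \<theta>"
    using eventually_gt_at_top[of 0] eventually_ge_at_top[of "\<Sum>i<N. 1 / c i"]
  proof eventually_elim
    case (elim \<theta>)
    have "1 / (3 * \<theta>) \<le> c i / (1 + 2 * c i * \<theta>)" if "i < N" for i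
    proof -
      have "1 / c i \<le> (\<Sum>i<N. 1 / c i)" using that c_pos by (intro member_le_sum) (auto simp: less_imp_le)
      also have "\<dots> \<le> \<theta>" using elim by simp
      finally have "1 \<le> c i * \<theta>" using c_pos[of i] by (simp add: divide_le_eq mult.commute)
      moreover have "0 < 1 + 2 * c i * \<theta>" using elim c_pos[of i] by (auto intro!: add_pos_pos)
      ultimately show ?thesis using elim by (simp add: frac_le_eq divide_le_0_iff mult_less_0_iff) (simp add: divide_simps algebra_simps)
    qed
    then have "(\<Sum>i<N. 1 / (3 * \<theta>)) \<le> (\<Sum>i<N. c i / (1 + 2 * c i * \<theta>))" by (intro sum_mono) auto
    also have "\<dots> \<le> \<mu> \<theta>"
      unfolding \<mu>_def using elim c_pos by (intro sum_le_suminf summable_mu) (auto simp: less_imp_le intro!: divide_nonneg_nonneg add_nonneg_nonneg)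
    finally have "\<theta> * (real N * (1 / (3 * \<theta>))) \<le> \<theta> * \<mu> \<theta>" using elim by (intro mult_left_mono) auto
    then show ?case using N elim by simp
  qed
qed

text \<open>Tonelli: \<open>Z_cdf t\<close> is the probability of \<open>Z \<le> t\<close>, and
  integrating \<open>exp (- \<theta> * t)\<close> over \<open>{Z \<omega>..}\<close> gives
  \<open>exp (- \<theta> * Z \<omega>) / \<theta>\<close>.\<close>

lemma laplace_Z_cdf:
  assumes \<theta>: "0 < \<theta>"
  shows "has_bochner_integral lborel (\<lambda>t. exp (- \<theta> * t) * Z_cdf t) (L \<theta> / \<theta>)"
proof (rule has_bochner_integral_nn_integral)
  have [measurable]: "Z_cdf \<in> borel_measurable borel" using Z_cdf_props(1) by (rule borel_measurable_mono)
  show "(\<lambda>t. exp (- \<theta> * t) * Z_cdf t) \<in> borel_measurable lborel" by measurable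
  interpret P: pair_sigma_finite M lborel ..
  have tail: "(\<integral>\<^sup>+t. ennreal (exp (- \<theta> * t)) * indicator {p..} t \<partial>lborel) = ennreal (exp (- \<theta> * p) / \<theta>)" for p
  proof -
    have "exp (- \<theta> * p) * (exp (- \<theta> * (t - p)) * indicator {p..} t) = exp (- \<theta> * t) * indicator {p..} t" for t
      by (simp add: mult.assoc[symmetric] exp_add[symmetric] right_diff_distrib)
    then have "has_bochner_integral lborel (\<lambda>t. exp (- \<theta> * t) * indicator {p..} t) (exp (- \<theta> * p) / \<theta>)"
      using has_bochner_integral_exp_right[OF \<theta>, of "exp (- \<theta> * p)" p] by (simp only:)
    then have "(\<integral>\<^sup>+t. ennreal (exp (- \<theta> * t) * indicator {p..} t) \<partial>lborel) = ennreal (exp (- \<theta> * p) / \<theta>)"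
      by (subst nn_integral_eq_integral) (auto simp: has_bochner_integral_iff)
    then show ?thesis by (simp add: ennreal_mult' ennreal_indicator)
  qed
  have "(\<integral>\<^sup>+t. ennreal (exp (- \<theta> * t) * Z_cdf t) \<partial>lborel)
      = (\<integral>\<^sup>+t. (\<integral>\<^sup>+\<omega>. ennreal (exp (- \<theta> * t)) * indicator {Z \<omega>..} t \<partial>M) \<partial>lborel)"
  proof (rule nn_integral_cong)
    fix t
    have "(\<integral>\<^sup>+\<omega>. ennreal (exp (- \<theta> * t)) * indicator {Z \<omega>..} t \<partial>M)
       = (\<integral>\<^sup>+\<omega>. ennreal (exp (- \<theta> * t)) * indicator {\<omega> \<in> space M. Z \<omega> \<le> t} \<omega> \<partial>M)"
      by (intro nn_integral_cong) (auto simp: indicator_def)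
    also have "\<dots> = ennreal (exp (- \<theta> * t)) * ennreal (Z_cdf t)"
      by (subst nn_integral_cmult_indicator) (auto simp: Z_cdf_def emeasure_eq_measure)
    finally show "ennreal (exp (- \<theta> * t) * Z_cdf t) = (\<integral>\<^sup>+\<omega>. ennreal (exp (- \<theta> * t)) * indicator {Z \<omega>..} t \<partial>M)"
      by (simp add: ennreal_mult')
  qed
  also have "\<dots> = (\<integral>\<^sup>+\<omega>. (\<integral>\<^sup>+t. ennreal (exp (- \<theta> * t)) * indicator {Z \<omega>..} t \<partial>lborel) \<partial>M)"
    \<comment> \<open>Unfolding the indicator exposes the comparison
      \<open>Z \<omega> \<le> t\<close>, from which joint measurability is derived.\<close>
    unfolding atLeast_def indicator_def mem_Collect_eq by (rule P.Fubini') measurable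
  also have "\<dots> = (\<integral>\<^sup>+\<omega>. ennreal (exp (- \<theta> * Z \<omega>) / \<theta>) \<partial>M)" by (simp only: tail)
  also have "\<dots> = ennreal (L \<theta> / \<theta>)"
    using integrable_exp_Z[of \<theta>] \<theta> by (subst nn_integral_eq_integral) (auto simp: L_def)
  finally show "(\<integral>\<^sup>+t. ennreal (exp (- \<theta> * t) * Z_cdf t) \<partial>lborel) = ennreal (L \<theta> / \<theta>)" .
qed (use Z_cdf_props L_pos[of \<theta>] \<theta> in auto)

text \<open>The first summand alone is almost surely positive, because a point has Lebesgue measure
  0.\<close>

lemma prob_Z_nonpos: "\<P>(\<omega> in M. Z \<omega> \<le> 0) = 0"
proof -
  have "AE y in lborel. 0 < ennreal (std_normal_density y) \<longrightarrow> y \<noteq> 0"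
    using AE_lborel_singleton[of "0::real"] by eventually_elim simp
  then have "AE \<omega> in M. x 0 \<omega> \<noteq> 0" by (subst distributed_AE2[OF dist]) auto
  with AE_S_le_Z have "AE \<omega> in M. \<not> Z \<omega> \<le> 0"
  proof eventually_elim
    case (elim \<omega>)
    then have "0 < S 1 \<omega>" using c_pos[of 0] by (simp add: S_def)
    then show ?case using elim(1)[rule_format, of 1] by linarith
  qed
  then show ?thesis by (intro prob_eq_0_AE) simp
qed

text \<open>\<open>\<mu>\<close> in the variable \<open>r = 1 / \<theta>\<close>, which extends continuously to \<open>r = 0\<close>; the auxiliary function is its inverse.\<close>

definition \<nu> :: "real \<Rightarrow> real" where "\<nu> r = (\<Sum>i. c i * r / (r + 2 * c i))"

lemma \<mu>_eq_\<nu>: "0 < \<theta> \<Longrightarrow> \<mu> \<theta> = \<nu> (1 / \<theta>)"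
proof -
  assume "0 < \<theta>"
  then have "c i / (1 + 2 * c i * \<theta>) = c i * (1 / \<theta>) / (1 / \<theta> + 2 * c i)" for i
    using c_pos[of i] by (simp add: divide_simps)
  then show ?thesis by (simp only: \<mu>_def \<nu>_def)
qed

lemma \<nu>_term_bound: "0 \<le> r \<Longrightarrow> norm (c i * r / (r + 2 * c i)) \<le> c i"
  using c_pos[of i] by (simp add: divide_le_eq)

lemma \<nu>_0: "\<nu> 0 = 0"
  by (simp add: \<nu>_def)

text \<open>The M-test applies with the bounds \<open>c i\<close>, uniformly in \<open>r\<close> and
  up to \<open>r = 0\<close>, which corresponds to \<open>\<theta>\<close> infinite.\<close>

lemma continuous_on_\<nu>: "continuous_on {0..} \<nu>"
proof (rule uniform_limit_theorem[where F=sequentially])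
  show "uniform_limit {0..} (\<lambda>n r. \<Sum>i<n. c i * r / (r + 2 * c i)) \<nu> sequentially"
    unfolding \<nu>_def[abs_def] by (rule Weierstrass_m_test[OF \<nu>_term_bound c_summable]) simp
  have "r + 2 * c i \<noteq> 0" if "0 \<le> r" for r i using that c_pos[of i] by linarith
  then show "\<forall>\<^sub>F n in sequentially. continuous_on {0..} (\<lambda>r. \<Sum>i<n. c i * r / (r + 2 * c i))"
    by (intro always_eventually allI continuous_intros) auto
qed simp

lemma \<nu>_strict_mono:
  assumes "0 \<le> r" "r < r'"
  shows "\<nu> r < \<nu> r'"
proof -
  have summ: "summable (\<lambda>i. c i * r / (r + 2 * c i))" if "0 \<le> r" for r
    by (rule summable_comparison_test'[OF c_summable \<nu>_term_bound[OF that]])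
  have lt: "c i * r / (r + 2 * c i) < c i * r' / (r' + 2 * c i)" for i
  proof -
    have "0 < r + 2 * c i" "0 < r' + 2 * c i" using assms c_pos[of i] by auto
    moreover have "c i * (c i * r) < c i * (c i * r')" using assms c_pos[of i] by simp
    ultimately show ?thesis by (simp add: divide_less_eq less_divide_eq) (simp add: divide_simps algebra_simps)
  qed
  have "0 < (\<Sum>i. c i * r' / (r' + 2 * c i) - c i * r / (r + 2 * c i))"
    using summ assms lt by (intro suminf_pos summable_diff) auto
  also have "\<dots> = \<nu> r' - \<nu> r" unfolding \<nu>_def using assms by (intro suminf_diff[symmetric] summ) auto
  finally show ?thesis by simp
qed

text \<open>If \<open>Z\<close> were almost surely at least \<open>s\<close>, then
  \<open>L \<beta> \<le> exp (- \<beta> * s)\<close>. But \<open>L_ratio\<close> limits the decay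
  rate beyond \<open>\<alpha>\<close> to \<open>\<mu> \<alpha>\<close>, which is below
  \<open>s / 2\<close> for large \<open>\<alpha>\<close> since \<open>\<nu>\<close> is continuous at
  0; letting \<open>\<beta>\<close> grow forces \<open>L \<alpha> \<le> 0\<close>.\<close>

lemma Z_cdf_pos:
  assumes "0 < s"
  shows "0 < Z_cdf s"
proof (rule ccontr)
  assume "\<not> 0 < Z_cdf s"
  then have "Z_cdf s = 0" using Z_cdf_props(2)[of s] by linarith
  then have "\<P>(\<omega> in M. Z \<omega> \<le> s) = 0" by (simp only: Z_cdf_def)
  then have large: "AE \<omega> in M. s \<le> Z \<omega>"
    by (subst (asm) prob_eq_0) (auto elim!: eventually_mono)
  have "((\<lambda>r. \<nu> r) \<longlongrightarrow> \<nu> 0) (at 0 within {0..})"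
    using continuous_on_\<nu> by (auto simp: continuous_on_def)
  then have "\<forall>\<^sub>F r in at_right 0. \<nu> r < s / 2"
    unfolding \<nu>_0 at_within_Ici_at_right using assms by (intro order_tendstoD(2)) auto
  then obtain r where r: "0 < r" "\<nu> r < s / 2"
    by (metis (mono_tags, lifting) eventually_at_right_field dense)
  define \<alpha> where "\<alpha> = 1 / r"
  have \<alpha>: "0 < \<alpha>" "\<mu> \<alpha> < s / 2" using r \<mu>_eq_\<nu>[of \<alpha>] by (auto simp: \<alpha>_def)
  have bound: "L \<alpha> \<le> exp (- \<beta> * (s / 2))" if "\<alpha> \<le> \<beta>" for \<beta>
  proof -
    have "L \<beta> \<le> expectation (\<lambda>_. exp (- \<beta> * s))"
      unfolding L_def
    proof (rule integral_mono_AE)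
      show "AE \<omega> in M. exp (- \<beta> * Z \<omega>) \<le> exp (- \<beta> * s)"
        using large by eventually_elim (use that \<alpha> in \<open>auto intro!: mult_left_mono\<close>)
    qed (use integrable_exp_Z[of \<beta>] that \<alpha> in auto)
    then have Lb: "L \<beta> \<le> exp (- \<beta> * s)" by (simp add: prob_space)
    have "L \<alpha> \<le> exp ((\<beta> - \<alpha>) * \<mu> \<alpha>) * L \<beta>" using L_ratio(2) \<alpha> that by simp
    also have "\<dots> \<le> exp (\<beta> * (s / 2)) * exp (- \<beta> * s)"
    proof (rule mult_mono[OF _ Lb])
      have "(\<beta> - \<alpha>) * \<mu> \<alpha> \<le> (\<beta> - \<alpha>) * (s / 2)" using \<alpha> that by (intro mult_left_mono) auto
      also have "\<dots> \<le> \<beta> * (s / 2)" using \<alpha> assms by (intro mult_right_mono) auto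
      finally show "exp ((\<beta> - \<alpha>) * \<mu> \<alpha>) \<le> exp (\<beta> * (s / 2))" by simp
    qed (use L_pos[of \<beta>] that \<alpha> in auto)
    also have "\<dots> = exp (- \<beta> * (s / 2))" unfolding exp_add[symmetric] by (simp add: field_simps)
    finally show ?thesis .
  qed
  have "((\<lambda>\<beta>. exp (- \<beta> * (s / 2))) \<longlongrightarrow> 0) at_top" using assms by real_asymp
  then have "L \<alpha> \<le> 0"
    by (rule tendsto_lowerbound[OF _ eventually_mono[OF eventually_ge_at_top[of \<alpha>] bound]]) simp_all
  then show False using L_pos[of \<alpha>] \<alpha> by simp
qed

end

section \<open>The auxiliary function and membership in \<open>Gamma0\<close>\<close>

context gaussian_quadratic_series
begin

lemma Z_cdf_nonpos: "s \<le> 0 \<Longrightarrow> Z_cdf s = 0"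
  using monoD[OF Z_cdf_props(1), of s 0] Z_cdf_props(2)[of s] prob_Z_nonpos[folded Z_cdf_def] by linarith

sublocale log_concave_laplace Z_cdf L \<mu>
  by unfold_locales
    (fact Z_cdf_props Z_cdf_pos log_concave_Z_cdf mu_growth mu_curvature laplace_Z_cdf
      | rule L_pos L_ratio; simp)+

text \<open>For positive \<open>s\<close>, log-concavity makes \<open>Z_cdf\<close> continuous, so
  its left limit at \<open>s\<close>, which is at most the strict probability, equals
  \<open>Z_cdf s\<close>. Elsewhere \<open>Z_cdf\<close> vanishes.\<close>

lemma prob_Z_less: "\<P>(\<omega> in M. Z \<omega> < s) = Z_cdf s"
proof (rule antisym)
  show le: "\<P>(\<omega> in M. Z \<omega> < s) \<le> Z_cdf s"
    unfolding Z_cdf_def by (rule finite_measure_mono) auto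
  show "Z_cdf s \<le> \<P>(\<omega> in M. Z \<omega> < s)"
  proof (cases "0 < s")
    case True
    have "continuous_on {0<..} Z_cdf" by (rule log_concave_continuous[OF log_concave_Z_cdf Z_cdf_pos])
    then have "isCont Z_cdf s" using True by (simp add: continuous_on_eq_continuous_at)
    then have "(Z_cdf \<longlongrightarrow> Z_cdf s) (at_left s)" by (simp add: isCont_def filterlim_at_split)
    moreover have "\<forall>\<^sub>F t in at_left s. Z_cdf t \<le> \<P>(\<omega> in M. Z \<omega> < s)"
      unfolding eventually_at_left_field Z_cdf_def
      by (intro exI[of _ "s - 1"] conjI allI impI finite_measure_mono) auto
    ultimately show ?thesis by (rule tendsto_upperbound) simp
  qed (simp add: Z_cdf_nonpos)
qed

lemma Z_cdf_right_continuous: "continuous (at_right s) Z_cdf"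
proof -
  interpret D: real_distribution "distr M borel Z" by (rule real_distribution_distr) simp
  have "cdf (distr M borel Z) = Z_cdf"
    by (rule ext) (auto simp: cdf_def Z_cdf_def measure_distr intro!: arg_cong[where f=prob])
  then show ?thesis using D.cdf_is_right_cont by simp
qed

text \<open>For \<open>s \<ge> suminf c\<close> no \<open>\<theta>\<close> solves the equation and
  \<open>THE\<close> is unspecified; only \<open>s\<close> near 0 matters for an auxiliary
  function.\<close>

definition \<rho> :: "real \<Rightarrow> real" where "\<rho> s = (if s \<le> 0 then 0 else 1 / (THE \<theta>. 0 < \<theta> \<and> \<mu> \<theta> = s))"

lemma \<nu>_pos: "0 < r \<Longrightarrow> 0 < \<nu> r"
  using \<nu>_strict_mono[of 0 r] by (simp add: \<nu>_0)

lemma \<nu>_inj: "0 \<le> r \<Longrightarrow> 0 \<le> r' \<Longrightarrow> \<nu> r = \<nu> r' \<Longrightarrow> r = r'"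
  using \<nu>_strict_mono[of r r'] \<nu>_strict_mono[of r' r] by (cases r r' rule: linorder_cases) auto

text \<open>Under \<open>r = 1 / \<theta>\<close> the function \<open>\<rho>\<close> becomes the
  inverse of \<open>\<nu>\<close>, so its behaviour at 0 is that of an ordinary inverse at an end
  point.\<close>

lemma \<rho>_\<nu>:
  assumes "0 \<le> r"
  shows "\<rho> (\<nu> r) = r"
proof (cases "r = 0")
  case False
  with assms have r: "0 < r" by simp
  have "(THE \<theta>. 0 < \<theta> \<and> \<mu> \<theta> = \<nu> r) = 1 / r"
  proof (rule the_equality)
    show "0 < 1 / r \<and> \<mu> (1 / r) = \<nu> r" using r \<mu>_eq_\<nu>[of "1 / r"] by simp
    fix \<theta> assume \<theta>: "0 < \<theta> \<and> \<mu> \<theta> = \<nu> r"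
    then have "\<nu> (1 / \<theta>) = \<nu> r" using \<mu>_eq_\<nu>[of \<theta>] by argo
    then have "1 / \<theta> = r" by (rule \<nu>_inj[rotated 2]) (use \<theta> r in simp_all)
    then show "\<theta> = 1 / r" by (metis divide_divide_eq_right div_by_1 mult_1)
  qed
  then show ?thesis using \<nu>_pos[OF r] r by (simp add: \<rho>_def)
qed (simp add: \<nu>_0 \<rho>_def)

text \<open>The end point 1 is an arbitrary choice: any compact interval starting at 0 yields a
  right neighbourhood of 0 on which \<open>\<rho>\<close> can be studied.\<close>

lemma \<nu>_image: "\<nu> ` {0..1} = {0..\<nu> 1}"
proof (intro equalityI subsetI)
  fix s assume "s \<in> \<nu> ` {0..1}"
  then obtain r where "0 \<le> r" "r \<le> 1" "s = \<nu> r" by auto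
  then show "s \<in> {0..\<nu> 1}"
    using \<nu>_pos[of r] \<nu>_strict_mono[of r 1] \<nu>_0 by (cases "r = 0"; cases "r = 1") (auto simp: less_imp_le)
next
  fix s assume "s \<in> {0..\<nu> 1}"
  then obtain r where "0 \<le> r" "r \<le> 1" "\<nu> r = s"
    using IVT'[of \<nu> 0 s 1] continuous_on_subset[OF continuous_on_\<nu>, of "{0..1}"] by (auto simp: \<nu>_0)
  then show "s \<in> \<nu> ` {0..1}" by auto
qed

lemma is_aux_fun_Z_cdf: "is_aux_fun Z_cdf \<rho>"
proof -
  have repr: "\<exists>r\<in>{0..1}. s = \<nu> r \<and> \<rho> s = r" if "s \<in> {0..\<nu> 1}" for s
    using that unfolding \<nu>_image[symmetric] by (auto simp: \<rho>_\<nu>)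
  \<comment> \<open>The inverse of a continuous injection on a compact set is continuous.\<close>
  have cont: "continuous_on {0..\<nu> 1} \<rho>"
    unfolding \<nu>_image[symmetric]
    by (rule continuous_on_inv) (auto simp: \<rho>_\<nu> intro: continuous_on_subset[OF continuous_on_\<nu>])
  have "\<rho> s \<le> \<rho> t" if "s \<in> {0..\<nu> 1}" "t \<in> {0..\<nu> 1}" "s \<le> t" for s t
    using repr[OF that(1)] repr[OF that(2)] that(3) \<nu>_strict_mono[of "\<rho> t" "\<rho> s"] by (force simp: not_less[symmetric])
  then have mono: "mono_on {0..\<nu> 1} \<rho>" by (auto intro!: mono_onI)
  have nonneg: "\<forall>s\<in>{0..\<nu> 1}. 0 \<le> \<rho> s" using repr by force
  have \<rho>0: "\<rho> 0 = 0" by (simp add: \<rho>_def)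
  have \<nu>1: "0 < \<nu> 1" by (rule \<nu>_pos) simp
  have ev: "\<forall>\<^sub>F s in at_right 0. 0 < \<rho> s \<and> \<nu> (\<rho> s) = s"
    unfolding eventually_at_right_field
  proof (intro exI[of _ "\<nu> 1"] conjI allI impI \<nu>1)
    fix s assume s: "0 < s" "s < \<nu> 1"
    then obtain r where r: "r \<in> {0..1}" "s = \<nu> r" "\<rho> s = r" using repr[of s] by auto
    then show "0 < \<rho> s" "\<nu> (\<rho> s) = s" using s \<nu>_0 by (cases "r = 0", auto)+
  qed
  have "(\<rho> \<longlongrightarrow> \<rho> 0) (at 0 within {0..\<nu> 1})"
    using cont \<nu>1 by (auto simp: continuous_on_def)
  then have "(\<rho> \<longlongrightarrow> 0) (at_right 0)"
    using \<nu>1 by (simp add: \<rho>0 at_within_Icc_at_right)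
  \<comment> \<open>The substitution \<open>\<theta> = 1 / \<rho> s\<close>, for which
    \<open>\<mu> \<theta> = s\<close>, turns the limit at infinity into the one at 0 from the
    right.\<close>
  then have "LIM s at_right 0. inverse (\<rho> s) :> at_top"
    by (rule filterlim_inverse_at_top) (use ev in \<open>auto elim: eventually_mono\<close>)
  from filterlim_compose[OF ratio_tendsto_exp this]
  have "((\<lambda>s. Z_cdf (\<mu> (inverse (\<rho> s)) + y / inverse (\<rho> s)) / Z_cdf (\<mu> (inverse (\<rho> s)))) \<longlongrightarrow> exp y) (at_right 0)" for y .
  moreover have "\<forall>\<^sub>F s in at_right 0. Z_cdf (\<mu> (inverse (\<rho> s)) + y / inverse (\<rho> s)) / Z_cdf (\<mu> (inverse (\<rho> s)))
      = Z_cdf (s + y * \<rho> s) / Z_cdf s" for y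
    using ev
  proof eventually_elim
    case (elim s)
    then have "\<mu> (inverse (\<rho> s)) = s" using \<mu>_eq_\<nu>[of "inverse (\<rho> s)"] by (simp add: inverse_eq_divide)
    then show ?case by (simp add: divide_inverse)
  qed
  ultimately have "((\<lambda>s. Z_cdf (s + y * \<rho> s) / Z_cdf s) \<longlongrightarrow> exp y) (at_right 0)" for y
    by (rule Lim_transform_eventually)
  then show ?thesis unfolding is_aux_fun_def using cont mono nonneg \<rho>0 \<nu>1 by blast
qed

lemma Z_cdf_Gamma0: "Z_cdf \<in> Gamma0"
  unfolding Gamma0_def mem_Collect_eq
  by (intro conjI allI impI exI[of _ \<rho>] Z_cdf_props Z_cdf_nonpos Z_cdf_right_continuous is_aux_fun_Z_cdf)

end

theorem theorem2:
  fixes M :: "'a measure" and x :: "nat \<Rightarrow> 'a \<Rightarrow> real" and a :: "nat \<Rightarrow> real"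
    and z :: "'a \<Rightarrow> real" and F \<mu> \<rho> :: "real \<Rightarrow> real"
  assumes "prob_space M"
    and "prob_space.indep_vars M (\<lambda>_. borel) x UNIV"
    and "\<And>i. distributed M lborel (x i) std_normal_density"
    and "\<And>i. 0 < a i" and "mono a"
    and "summable (\<lambda>i. 1 / (a i)\<^sup>2)"
    and "\<And>\<omega>. z \<omega> = (\<Sum>i. (x i \<omega>)\<^sup>2 / (a i)\<^sup>2)"
    and "\<And>s. F s = measure M {\<omega> \<in> space M. z \<omega> < s}"
    and "\<And>\<theta>. \<mu> \<theta> = (\<Sum>i. 1 / ((a i)\<^sup>2 + 2 * \<theta>))"
    and "\<And>s. \<rho> s = (if s \<le> 0 then 0 else 1 / (THE \<theta>. 0 < \<theta> \<and> \<mu> \<theta> = s))"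
  shows "F \<in> Gamma0 \<and> is_aux_fun F \<rho>"
proof -
  define c where "c i = 1 / (a i)\<^sup>2" for i
  have a: "(a i)\<^sup>2 \<noteq> 0" for i using assms(4)[of i] by simp
  interpret prob_space M by fact
  interpret Q: gaussian_quadratic_series M x c
  proof
    show "indep_vars (\<lambda>_. borel) x UNIV" by fact
    show "distributed M lborel (x i) std_normal_density" for i by fact
    show "0 < c i" for i using assms(4)[of i] by (simp add: c_def)
    show "summable c" unfolding c_def by fact
  qed
  have "z = Q.Z" by (rule ext) (simp add: assms(7) Q.Z_def c_def)
  then have F: "F = Q.Z_cdf" by (intro ext) (simp add: assms(8) Q.prob_Z_less)
  \<comment> \<open>The identity must hold for every real \<open>\<theta>\<close>, since whole
    functions are identified next. Where a denominator vanishes both do, and both quotients are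
    0.\<close>
  have "c i / (1 + 2 * c i * \<theta>) = 1 / ((a i)\<^sup>2 + 2 * \<theta>)" for i \<theta>
  proof -
    have "1 + 2 * c i * \<theta> = ((a i)\<^sup>2 + 2 * \<theta>) / (a i)\<^sup>2"
      using a[of i] by (simp add: c_def add_divide_distrib)
    then show ?thesis using a[of i] by (simp add: c_def)
  qed
  then have "\<mu> = Q.\<mu>" by (intro ext) (simp add: assms(9) Q.\<mu>_def)
  then have "\<rho> = Q.\<rho>" by (intro ext) (simp add: assms(10) Q.\<rho>_def)
  then show ?thesis using F Q.Z_cdf_Gamma0 Q.is_aux_fun_Z_cdf by simp
qed

end
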